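(* Assume $\diamondsuit^+$. There is a map $X\mapsto T^X$ from subsets of $\omega_1$ to downward closed $\aleph_1$-subtrees of $2^{<\omega_1}$ such that (1) if $X\cap\alpha=Y\cap\alpha$ then $T^X\upharpoonright\alpha=T^Y\upharpoonright\alpha$; (2) if $X$ is stationary then $T^X$ is a Suslin tree; (3) if $X$ is non-stationary then $T^X$ is a special Aronszajn tree.
   Context: $2^{<\omega_1}$ is the set of binary sequences of countable length, ordered by end-extension; a subtree $T\subseteq 2^{<\omega_1}$ is downward closed if closed under initial segments, and an $\aleph_1$-subtree if each level $T_\xi$ ($\xi<\omega_1$) is countable and nonempty. $T\upharpoonright\alpha$ denotes the set of nodes of $T$ of height less than $\alpha$. An Aronszajn tree is an $\aleph_1$-tree without uncountable branches; a Suslin tree is an Aronszajn tree without uncountable antichains; a special Aronszajn tree is an Aronszajn tree which is a union of countably many antichains. $\diamondsuit^+$ asserts the existence of a sequence $(\mathcal A_\alpha)_{\alpha<\omega_1}$ of countable sets such that for every $X\subseteq\omega_1$ there is a club $C\subseteq\omega_1$ with $C\cap\alpha, X\cap\alpha\in\mathcal A_\alpha$ for all $\alpha\in C$. *)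

theory Defs
  imports Main "HOL-Library.Countable_Set"
begin

section \<open>The first uncountable ordinal\<close>

text \<open>The elements of \<open>omega1\<close> are the countable ordinals; the ordinal \<open>\<alpha> < \<omega>\<^sub>1\<close>, as a set,
  is \<open>{..<\<alpha>}\<close>.\<close>

typedef omega1 = "Field (cardSuc natLeq)"
proof -
  have "infinite (Field (cardSuc natLeq))"
    using cardSuc_finite[OF natLeq_Card_order] by (simp add: Field_natLeq)
  then show ?thesis using infinite_imp_nonempty by blast
qed

lemma Well_order_cardSuc_natLeq: "Well_order (cardSuc natLeq)"
  by (rule card_order_on_well_order_on[OF cardSuc_Card_order[OF natLeq_Card_order]])

instantiation omega1 :: wellorder
begin

definition less_eq_omega1 :: "omega1 \<Rightarrow> omega1 \<Rightarrow> bool"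
  where "x \<le> y \<longleftrightarrow> (Rep_omega1 x, Rep_omega1 y) \<in> cardSuc natLeq"

definition less_omega1 :: "omega1 \<Rightarrow> omega1 \<Rightarrow> bool"
  where "(x::omega1) < y \<longleftrightarrow> x \<le> y \<and> x \<noteq> y"

instance
proof
  let ?r = "cardSuc natLeq"
  have lin: "Linear_order ?r" and wf: "wf (?r - Id)"
    using Well_order_cardSuc_natLeq by (simp_all add: well_order_on_def)
  have refl: "refl_on (Field ?r) ?r" and trans: "trans ?r" and antisym: "antisym ?r"
    and total: "total_on (Field ?r) ?r"
    using lin by (simp_all add: linear_order_on_def partial_order_on_def preorder_on_def)
  fix x y z :: omega1
  show le_refl: "x \<le> x"
    unfolding less_eq_omega1_def using refl Rep_omega1 by (rule refl_onD)
  show "x \<le> y \<Longrightarrow> y \<le> z \<Longrightarrow> x \<le> z"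
    unfolding less_eq_omega1_def using trans by (rule transD)
  show anti: "x \<le> y \<Longrightarrow> y \<le> x \<Longrightarrow> x = y"
    unfolding less_eq_omega1_def using antisymD[OF antisym] by (simp add: Rep_omega1_inject[symmetric])
  show "x < y \<longleftrightarrow> x \<le> y \<and> \<not> y \<le> x"
    unfolding less_omega1_def using anti le_refl by blast
  show "x \<le> y \<or> y \<le> x"
    using total le_refl Rep_omega1[of x] Rep_omega1[of y]
    unfolding less_eq_omega1_def
    by (cases "x = y") (simp_all add: total_on_def less_eq_omega1_def Rep_omega1_inject)
  fix P :: "omega1 \<Rightarrow> bool" and a
  assume step: "\<And>x. (\<And>y. y < x \<Longrightarrow> P y) \<Longrightarrow> P x"
  have wf': "wf (inv_image (?r - Id) Rep_omega1)"
    using wf by (rule wf_inv_image)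
  show "P a"
    using wf'
  proof (induction a rule: wf_induct_rule)
    case (less x)
    show ?case
    proof (rule step)
      fix y assume "y < x"
      then have "(y, x) \<in> inv_image (?r - Id) Rep_omega1"
        by (simp add: less_omega1_def less_eq_omega1_def Rep_omega1_inject)
      then show "P y" by (rule less)
    qed
  qed
qed

end

lemma uncountable_omega1: "uncountable (UNIV :: omega1 set)"
proof
  assume "countable (UNIV :: omega1 set)"
  then have "countable (range Rep_omega1)" by (rule countable_image)
  then have "countable (Field (cardSuc natLeq))"
    using type_definition.Rep_range[OF type_definition_omega1] by simp
  then obtain f :: "nat set \<Rightarrow> nat" where "inj_on f (Field (cardSuc natLeq))"
    by (auto simp: countable_def)
  then have "ordLeq3 (card_of (Field (cardSuc natLeq))) (card_of (UNIV :: nat set))"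
    unfolding card_of_ordLeq[symmetric] by blast
  moreover have "ordIso2 (card_of (Field (cardSuc natLeq))) (cardSuc natLeq)"
    by (rule card_of_Field_ordIso[OF cardSuc_Card_order[OF natLeq_Card_order]])
  moreover have "ordIso2 (card_of (UNIV :: nat set)) natLeq"
    by (rule card_of_nat)
  ultimately have "ordLeq3 (cardSuc natLeq) natLeq"
    using ordIso_ordLeq_trans[OF ordIso_symmetric] ordLeq_ordIso_trans by metis
  then show False
    using not_ordLess_ordLeq[OF cardSuc_greater[OF natLeq_Card_order]] by simp
qed

lemma countable_lessThan_omega1: "countable {..<\<alpha> :: omega1}"
proof -
  let ?r = "cardSuc natLeq" and ?a = "Rep_omega1 \<alpha>"
  have "ordLess2 (card_of (underS ?r ?a)) ?r"
    using card_of_underS[OF cardSuc_Card_order[OF natLeq_Card_order] Rep_omega1] .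
  then have "ordLeq3 (card_of (underS ?r ?a)) natLeq"
    unfolding cardSuc_ordLeq_ordLess[OF natLeq_Card_order card_of_Card_order] .
  then have "ordLeq3 (card_of (underS ?r ?a)) (card_of (UNIV :: nat set))"
    by (rule ordLeq_ordIso_trans) (rule ordIso_symmetric[OF card_of_nat])
  then obtain g :: "nat set \<Rightarrow> nat" where "inj_on g (underS ?r ?a)"
    unfolding card_of_ordLeq[symmetric] by blast
  then have "countable (underS ?r ?a)" by (auto simp: countable_def)
  moreover have "Rep_omega1 ` {..<\<alpha>} \<subseteq> underS ?r ?a"
    by (auto simp: underS_def less_omega1_def less_eq_omega1_def Rep_omega1_inject)
  ultimately have "countable (Rep_omega1 ` {..<\<alpha>})"
    using countable_subset by blast
  then show ?thesis
    by (rule countable_image_inj_on) (simp add: inj_on_def Rep_omega1_inject)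
qed


section \<open>Clubs, stationary sets and diamond plus\<close>

definition unbounded :: "omega1 set \<Rightarrow> bool"
  where "unbounded C \<longleftrightarrow> (\<forall>\<alpha>. \<exists>\<beta>\<in>C. \<alpha> < \<beta>)"

text \<open>The two premises make \<open>\<alpha>\<close> a limit ordinal with \<open>C \<inter> \<alpha>\<close> unbounded in \<open>\<alpha>\<close>.\<close>

definition order_closed :: "omega1 set \<Rightarrow> bool"
  where "order_closed C \<longleftrightarrow>
    (\<forall>\<alpha>. {..<\<alpha>} \<noteq> {} \<longrightarrow> (\<forall>\<beta><\<alpha>. \<exists>\<gamma>\<in>C. \<beta> < \<gamma> \<and> \<gamma> < \<alpha>) \<longrightarrow> \<alpha> \<in> C)"

definition club :: "omega1 set \<Rightarrow> bool"
  where "club C \<longleftrightarrow> order_closed C \<and> unbounded C"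

definition stationary :: "omega1 set \<Rightarrow> bool"
  where "stationary S \<longleftrightarrow> (\<forall>C. club C \<longrightarrow> S \<inter> C \<noteq> {})"

definition diamond_plus :: bool
  where "diamond_plus \<longleftrightarrow>
    (\<exists>\<A> :: omega1 \<Rightarrow> omega1 set set.
      (\<forall>\<alpha>. countable (\<A> \<alpha>)) \<and>
      (\<forall>X. \<exists>C. club C \<and> (\<forall>\<alpha>\<in>C. C \<inter> {..<\<alpha>} \<in> \<A> \<alpha> \<and> X \<inter> {..<\<alpha>} \<in> \<A> \<alpha>)))"


section \<open>Subtrees of the tree of countable binary sequences\<close>

text \<open>A binary sequence of length \<open>\<alpha>\<close> is a partial function with domain \<open>{..<\<alpha>}\<close>;
  end-extension is then \<open>(\<subseteq>\<^sub>m)\<close>.\<close>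

type_synonym binseq = "omega1 \<rightharpoonup> bool"

definition binseqs :: "binseq set"
  where "binseqs = {s. \<exists>\<alpha>. dom s = {..<\<alpha>}}"

definition subtree :: "binseq set \<Rightarrow> bool"
  where "subtree T \<longleftrightarrow> T \<subseteq> binseqs"

definition downward_closed :: "binseq set \<Rightarrow> bool"
  where "downward_closed T \<longleftrightarrow> (\<forall>t\<in>T. \<forall>s\<in>binseqs. s \<subseteq>\<^sub>m t \<longrightarrow> s \<in> T)"

definition predecessors :: "binseq set \<Rightarrow> binseq \<Rightarrow> binseq set"
  where "predecessors T t = {s \<in> T. s \<subseteq>\<^sub>m t \<and> s \<noteq> t}"

text \<open>The height of \<open>t\<close> in \<open>T\<close> is the order type of its set of predecessors.\<close>

definition has_height :: "binseq set \<Rightarrow> binseq \<Rightarrow> omega1 \<Rightarrow> bool"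
  where "has_height T t \<xi> \<longleftrightarrow>
    (\<exists>f. bij_betw f {..<\<xi>} (predecessors T t) \<and>
         (\<forall>\<beta><\<xi>. \<forall>\<gamma><\<xi>. \<beta> \<le> \<gamma> \<longleftrightarrow> f \<beta> \<subseteq>\<^sub>m f \<gamma>))"

definition level :: "binseq set \<Rightarrow> omega1 \<Rightarrow> binseq set"
  where "level T \<xi> = {t \<in> T. has_height T t \<xi>}"

definition tree_restrict :: "binseq set \<Rightarrow> omega1 \<Rightarrow> binseq set"
  where "tree_restrict T \<alpha> = {t \<in> T. \<exists>\<xi><\<alpha>. has_height T t \<xi>}"

definition aleph1_subtree :: "binseq set \<Rightarrow> bool"
  where "aleph1_subtree T \<longleftrightarrow>
    subtree T \<and> (\<forall>\<xi>. countable (level T \<xi>) \<and> level T \<xi> \<noteq> {})"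

abbreviation branch :: "binseq set \<Rightarrow> binseq set \<Rightarrow> bool"
  where "branch T B \<equiv> pred_on.maxchain T (\<subseteq>\<^sub>m) B"

definition antichain :: "binseq set \<Rightarrow> binseq set \<Rightarrow> bool"
  where "antichain T A \<longleftrightarrow> A \<subseteq> T \<and> (\<forall>s\<in>A. \<forall>t\<in>A. s \<noteq> t \<longrightarrow> \<not> s \<subseteq>\<^sub>m t \<and> \<not> t \<subseteq>\<^sub>m s)"

definition aronszajn_tree :: "binseq set \<Rightarrow> bool"
  where "aronszajn_tree T \<longleftrightarrow> aleph1_subtree T \<and> \<not> (\<exists>B. branch T B \<and> uncountable B)"

definition suslin_tree :: "binseq set \<Rightarrow> bool"
  where "suslin_tree T \<longleftrightarrow> aronszajn_tree T \<and> \<not> (\<exists>A. antichain T A \<and> uncountable A)"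

definition special_aronszajn_tree :: "binseq set \<Rightarrow> bool"
  where "special_aronszajn_tree T \<longleftrightarrow>
    aronszajn_tree T \<and> (\<exists>\<F>. countable \<F> \<and> (\<forall>A\<in>\<F>. antichain T A) \<and> T = \<Union>\<F>)"


section \<open>In downward closed subtrees, height is length\<close>

lemma order_iso_lessThan_le:
  fixes g :: "omega1 \<Rightarrow> omega1"
  assumes bij: "bij_betw g {..<\<xi>} {..<\<eta>}"
    and ord: "\<And>\<beta> \<gamma>. \<beta> < \<xi> \<Longrightarrow> \<gamma> < \<xi> \<Longrightarrow> \<beta> \<le> \<gamma> \<longleftrightarrow> g \<beta> \<le> g \<gamma>"
  shows "\<xi> \<le> \<eta>"
proof (rule ccontr)
  have ge: "\<beta> < \<xi> \<Longrightarrow> \<beta> \<le> g \<beta>" for \<beta>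
  proof (induction \<beta> rule: less_induct)
    case (less \<beta>)
    show ?case
    proof (rule ccontr)
      assume *: "\<not> \<beta> \<le> g \<beta>"
      then have "g \<beta> < \<xi>" using less.prems by auto
      then have "g \<beta> \<le> g (g \<beta>)" using less.IH * by auto
      then show False using ord[of \<beta> "g \<beta>"] * \<open>g \<beta> < \<xi>\<close> less.prems by auto
    qed
  qed
  assume "\<not> \<xi> \<le> \<eta>"
  then have "\<eta> < \<xi>" by auto
  then have "g \<eta> < \<eta>" using bij by (auto simp: bij_betw_def)
  then show False using ge[OF \<open>\<eta> < \<xi>\<close>] by auto
qed

lemma has_height_iff_dom:
  assumes T: "subtree T" "downward_closed T" and t: "t \<in> T"
  shows "has_height T t \<xi> \<longleftrightarrow> dom t = {..<\<xi>}"
proof -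
  obtain \<eta> where \<eta>: "dom t = {..<\<eta>}"
    using T t by (auto simp: subtree_def binseqs_def)
  define h where "h = (\<lambda>\<beta>. t |` {..<\<beta>})"
  have dom_h: "dom (h \<beta>) = {..<\<beta>}" if "\<beta> \<le> \<eta>" for \<beta>
    using that \<eta> by (auto simp: h_def)
  have h_le: "\<beta> \<le> \<gamma> \<longleftrightarrow> h \<beta> \<subseteq>\<^sub>m h \<gamma>" if "\<beta> < \<eta>" "\<gamma> < \<eta>" for \<beta> \<gamma>
  proof
    show "h \<beta> \<subseteq>\<^sub>m h \<gamma>" if "\<beta> \<le> \<gamma>"
      using that by (auto simp: h_def map_le_def restrict_map_def split: if_splits)
    assume "h \<beta> \<subseteq>\<^sub>m h \<gamma>"
    then have "dom (h \<beta>) \<subseteq> dom (h \<gamma>)" by (rule map_le_implies_dom_le)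
    then show "\<beta> \<le> \<gamma>" using dom_h that by auto
  qed
  have img: "h ` {..<\<eta>} = predecessors T t"
  proof (intro equalityI subsetI)
    fix s assume "s \<in> h ` {..<\<eta>}"
    then obtain \<beta> where \<beta>: "\<beta> < \<eta>" "s = h \<beta>" by auto
    have "s \<in> binseqs" using \<beta> dom_h by (auto simp: binseqs_def)
    moreover have "s \<subseteq>\<^sub>m t" by (auto simp: \<beta> h_def map_le_def restrict_map_def split: if_splits)
    moreover have "s \<noteq> t"
      using \<beta> dom_h[of \<beta>] \<eta> by (metis less_imp_le lessThan_eq_iff less_irrefl)
    ultimately show "s \<in> predecessors T t"
      using T t by (auto simp: predecessors_def downward_closed_def)
  next
    fix s assume s: "s \<in> predecessors T t"
    then have "s \<in> T" "s \<subseteq>\<^sub>m t" "s \<noteq> t" by (auto simp: predecessors_def)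
    then obtain \<beta> where \<beta>: "dom s = {..<\<beta>}"
      using T by (auto simp: subtree_def binseqs_def)
    have s_eq: "s = h \<beta>"
    proof
      fix x
      show "s x = h \<beta> x"
      proof (cases "x < \<beta>")
        case True
        then have "x \<in> dom s" using \<beta> by auto
        then show ?thesis using True \<open>s \<subseteq>\<^sub>m t\<close> by (simp add: map_le_def h_def)
      next
        case False
        then have "x \<notin> dom s" using \<beta> by auto
        then show ?thesis using False by (auto simp: h_def domIff)
      qed
    qed
    have "{..<\<beta>} \<subseteq> {..<\<eta>}" using \<open>s \<subseteq>\<^sub>m t\<close> \<beta> \<eta> map_le_implies_dom_le by metis
    moreover have "\<beta> \<noteq> \<eta>"
    proof
      assume "\<beta> = \<eta>"
      then have "h \<beta> = t"
        using map_le_antisym[of "h \<beta>" t] dom_h[of \<beta>] \<eta> by (auto simp: h_def map_le_def)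
      then show False using s_eq \<open>s \<noteq> t\<close> by simp
    qed
    ultimately have "\<beta> < \<eta>" by auto
    then show "s \<in> h ` {..<\<eta>}" using s_eq by auto
  qed
  have inj: "inj_on h {..<\<eta>}"
  proof (rule inj_onI)
    fix \<beta> \<gamma> assume *: "\<beta> \<in> {..<\<eta>}" "\<gamma> \<in> {..<\<eta>}" "h \<beta> = h \<gamma>"
    then have "\<beta> \<le> \<gamma>" "\<gamma> \<le> \<beta>" using h_le[of \<beta> \<gamma>] h_le[of \<gamma> \<beta>] by auto
    then show "\<beta> = \<gamma>" by auto
  qed
  have bij: "bij_betw h {..<\<eta>} (predecessors T t)"
    using inj img by (simp add: bij_betw_def)
  have unique: "\<xi> = \<eta>" if hh: "has_height T t \<xi>"
  proof -
    obtain f where f: "bij_betw f {..<\<xi>} (predecessors T t)"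
      and f_le: "\<And>\<beta> \<gamma>. \<beta> < \<xi> \<Longrightarrow> \<gamma> < \<xi> \<Longrightarrow> \<beta> \<le> \<gamma> \<longleftrightarrow> f \<beta> \<subseteq>\<^sub>m f \<gamma>"
      using hh unfolding has_height_def by blast
    define k where "k = inv_into {..<\<eta>} h"
    have k: "bij_betw k (predecessors T t) {..<\<eta>}"
      unfolding k_def using bij by (rule bij_betw_inv_into)
    have hk: "h (k s) = s" if "s \<in> predecessors T t" for s
      unfolding k_def using bij that by (simp add: bij_betw_inv_into_right)
    have kf: "bij_betw (k \<circ> f) {..<\<xi>} {..<\<eta>}" using f k by (rule bij_betw_trans)
    have kf_le: "\<beta> \<le> \<gamma> \<longleftrightarrow> (k \<circ> f) \<beta> \<le> (k \<circ> f) \<gamma>" if "\<beta> < \<xi>" "\<gamma> < \<xi>" for \<beta> \<gamma>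
    proof -
      have P: "f \<beta> \<in> predecessors T t" "f \<gamma> \<in> predecessors T t"
        using f that by (auto simp: bij_betw_def)
      then have "k (f \<beta>) < \<eta>" "k (f \<gamma>) < \<eta>" using k by (auto simp: bij_betw_def)
      then show ?thesis using h_le[of "k (f \<beta>)" "k (f \<gamma>)"] hk P f_le that by simp
    qed
    have le1: "\<xi> \<le> \<eta>" using kf kf_le by (rule order_iso_lessThan_le)
    define m where "m = inv_into {..<\<xi>} (k \<circ> f)"
    have m: "bij_betw m {..<\<eta>} {..<\<xi>}"
      unfolding m_def using kf by (rule bij_betw_inv_into)
    have km: "(k \<circ> f) (m \<beta>) = \<beta>" if "\<beta> < \<eta>" for \<beta>
      unfolding m_def by (rule bij_betw_inv_into_right[OF kf]) (use that in simp)
    have "\<beta> \<le> \<gamma> \<longleftrightarrow> m \<beta> \<le> m \<gamma>" if "\<beta> < \<eta>" "\<gamma> < \<eta>" for \<beta> \<gamma>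
    proof -
      have "m \<beta> < \<xi>" "m \<gamma> < \<xi>" using m that by (auto simp: bij_betw_def)
      then show ?thesis using kf_le[of "m \<beta>" "m \<gamma>"] km that by simp
    qed
    then have "\<eta> \<le> \<xi>" using order_iso_lessThan_le[OF m] by blast
    with le1 show ?thesis by auto
  qed
  have "has_height T t \<eta>"
    unfolding has_height_def by (rule exI[of _ h]) (use bij h_le in simp)
  then have "has_height T t \<xi> \<longleftrightarrow> \<xi> = \<eta>"
    using unique by metis
  then show ?thesis
    unfolding \<eta> lessThan_eq_iff by metis
qed

end

theory Submission
  imports Defs
begin

text \<open>
  Call a set \<open>d\<close> of limit ordinals good for \<open>X\<close> if it is closed, disjoint from \<open>X\<close>, and
  \<open>d \<inter> \<delta>\<close> is guessed at every \<open>\<delta> \<in> d\<close>. The tree is built level by level, with all one-bit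
  extensions at successors. At a limit \<open>\<alpha> \<in> X\<close> the cofinal branches that are continued decide every
  guessed subset of \<open>T \<restriction> \<alpha>\<close>, as in Jensen's construction of a Suslin tree. At a limit
  \<open>\<alpha> \<notin> X\<close> the branches \<open>t\<close> that are continued are such that, for each of the countably many
  good sets \<open>d\<close> with maximum \<open>\<alpha>\<close>, the map sending \<open>\<delta> \<in> d\<close> to the index of \<open>t \<restriction> \<delta>\<close> in a fixed
  enumeration of level \<open>\<delta>\<close> is finite-to-one. The two requirements never interfere: a good set
  avoids \<open>X\<close> and is closed, so it is bounded below each \<open>\<alpha> \<in> X\<close>.

  If \<open>X\<close> is non-stationary, diamond plus yields a good club \<open>C\<close>. A node \<open>t\<close> of height \<open>\<delta> \<in> C\<close> is
  then labelled by its index and the number of \<open>\<eta> \<in> C \<inter> \<delta>\<close> where \<open>t \<restriction> \<eta>\<close> has the same index; these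
  labels are distinct along chains, which specializes the tree on the levels in \<open>C\<close>, hence everywhere.
\<close>

section \<open>Clubs and bounds in the first uncountable ordinal\<close>

text \<open>An unbounded countable set would make \<open>omega1\<close> a countable union of
  countable initial segments.\<close>

lemma countable_imp_bounded_omega1:
  fixes A :: "omega1 set"
  assumes "countable A"
  obtains \<beta> where "\<And>a. a \<in> A \<Longrightarrow> a < \<beta>"
proof (rule ccontr)
  assume "\<not> thesis"
  then have "\<forall>\<beta>. \<exists>a\<in>A. \<beta> \<le> a" using that not_less by blast
  then have "(UNIV :: omega1 set) = (\<Union>a\<in>A. insert a {..<a})"
    by (auto simp: le_less)
  moreover have "countable (\<Union>a\<in>A. insert a {..<a})"
    using assms countable_lessThan_omega1 by auto
  ultimately show False using uncountable_omega1 by simp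
qed

lemma omega1_gt_ex: "\<exists>\<gamma> :: omega1. \<beta> < \<gamma>"
  using countable_imp_bounded_omega1[of "{\<beta>}"] by auto

definition limit_ord :: "omega1 \<Rightarrow> bool"
  where "limit_ord \<alpha> \<longleftrightarrow> {..<\<alpha>} \<noteq> {} \<and> (\<forall>\<beta><\<alpha>. \<exists>\<gamma>. \<beta> < \<gamma> \<and> \<gamma> < \<alpha>)"

text \<open>Sets of this form are clubs, and every club contains one of them, so intersecting clubs
  reduces to combining functions.\<close>

definition closure_points :: "(omega1 \<Rightarrow> omega1) \<Rightarrow> omega1 set"
  where "closure_points g = {\<alpha>. {..<\<alpha>} \<noteq> {} \<and> (\<forall>\<xi><\<alpha>. g \<xi> < \<alpha>)}"

lemma club_closure_points: "club (closure_points g)"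
  unfolding club_def
proof
  show "order_closed (closure_points g)"
    unfolding order_closed_def closure_points_def
    by (smt (verit, best) mem_Collect_eq less_trans)
  show "unbounded (closure_points g)"
    unfolding unbounded_def
  proof
    fix \<alpha>
    \<comment> \<open>\<open>h (Suc n)\<close> is placed above all values of \<open>g\<close> on the
      whole initial segment up to \<open>h n\<close>, since \<open>g\<close> need not be monotone.
      The supremum of \<open>h\<close> is then closed under \<open>g\<close>.\<close>
    have "\<exists>h. \<alpha> < h 0 \<and> (\<forall>n. h n < h (Suc n) \<and> (\<forall>\<xi>\<le>h n. g \<xi> < h (Suc n)))"
    proof -
      have "\<exists>h. \<forall>n. \<alpha> < h n \<and> (h n < h (Suc n) \<and> (\<forall>\<xi>\<le>h n. g \<xi> < h (Suc n)))"
      proof (rule dependent_nat_choice)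
        show "\<exists>x. \<alpha> < x" by (rule omega1_gt_ex)
        fix x :: omega1 and n :: nat
        assume "\<alpha> < x"
        have "{..x} = insert x {..<x}" by auto
        then have "countable (insert x (g ` {..x}))" using countable_lessThan_omega1 by simp
        then obtain y where "\<And>a. a \<in> insert x (g ` {..x}) \<Longrightarrow> a < y"
          using countable_imp_bounded_omega1 by blast
        then show "\<exists>y>\<alpha>. x < y \<and> (\<forall>\<xi>\<le>x. g \<xi> < y)"
          using \<open>\<alpha> < x\<close> by (intro exI[of _ y]) (auto intro: less_trans)
      qed
      then show ?thesis by blast
    qed
    then obtain h where h: "\<alpha> < h 0" "\<And>n. h n < h (Suc n)" "\<And>n \<xi>. \<xi> \<le> h n \<Longrightarrow> g \<xi> < h (Suc n)"
      by blast
    obtain \<beta>0 where "\<And>n. h n < \<beta>0"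
      using countable_imp_bounded_omega1[of "range h"] by (metis countable_image countableI_type rangeI)
    define \<beta> where "\<beta> = (LEAST \<beta>. \<forall>n. h n < \<beta>)"
    have \<beta>: "h n < \<beta>" for n
      unfolding \<beta>_def using LeastI[of "\<lambda>\<beta>. \<forall>n. h n < \<beta>" \<beta>0] \<open>\<And>n. h n < \<beta>0\<close> by blast
    have "g \<xi> < \<beta>" if "\<xi> < \<beta>" for \<xi>
    proof -
      have "\<not> (\<forall>n. h n < \<xi>)" using not_less_Least that unfolding \<beta>_def by blast
      then obtain n where "\<xi> \<le> h n" by (auto simp: not_less)
      then show ?thesis using h(3)[of \<xi> n] \<beta>[of "Suc n"] by (auto intro: less_trans)
    qed
    then have "\<beta> \<in> closure_points g"
      unfolding closure_points_def using \<beta> by auto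
    moreover have "\<alpha> < \<beta>" using h(1) \<beta>[of 0] by auto
    ultimately show "\<exists>\<beta>\<in>closure_points g. \<alpha> < \<beta>" by blast
  qed
qed

text \<open>Let \<open>g \<xi>\<close> be an element of \<open>C\<close> above \<open>\<xi>\<close>:
  a point closed under \<open>g\<close> is a limit of elements of \<open>C\<close>.\<close>

lemma closure_points_subset_club:
  assumes "club C"
  obtains g where "closure_points g \<subseteq> C"
proof -
  have "\<forall>\<xi>. \<exists>\<gamma>\<in>C. \<xi> < \<gamma>" using assms by (auto simp: club_def unbounded_def)
  then obtain g where g: "\<And>\<xi>. g \<xi> \<in> C \<and> \<xi> < g \<xi>" by metis
  have "closure_points g \<subseteq> C"
  proof
    fix \<alpha> assume "\<alpha> \<in> closure_points g"
    then have "{..<\<alpha>} \<noteq> {}" "\<forall>\<beta><\<alpha>. \<exists>\<gamma>\<in>C. \<beta> < \<gamma> \<and> \<gamma> < \<alpha>"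
      using g unfolding closure_points_def by blast+
    then show "\<alpha> \<in> C" using assms unfolding club_def order_closed_def by blast
  qed
  then show ?thesis using that by blast
qed

text \<open>A point closed under the maximum of two functions is closed under both, which gives
  unboundedness.\<close>

lemma club_Int:
  assumes C: "club C" and D: "club D"
  shows "club (C \<inter> D)"
proof -
  obtain g h where gh: "closure_points g \<subseteq> C" "closure_points h \<subseteq> D"
    using closure_points_subset_club C D by metis
  have "closure_points (\<lambda>\<xi>. max (g \<xi>) (h \<xi>)) \<subseteq> C \<inter> D"
    using gh unfolding closure_points_def by auto
  moreover have "unbounded (closure_points (\<lambda>\<xi>. max (g \<xi>) (h \<xi>)))"
    using club_closure_points by (auto simp: club_def)
  ultimately have "unbounded (C \<inter> D)" unfolding unbounded_def by blast
  moreover have "order_closed (C \<inter> D)"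
    using C D unfolding club_def order_closed_def by (metis IntD1 IntD2 IntI)
  ultimately show ?thesis by (simp add: club_def)
qed

lemma club_limit_ord: "club {\<alpha>. limit_ord \<alpha>}"
proof -
  obtain s :: "omega1 \<Rightarrow> omega1" where s: "\<And>\<xi>. \<xi> < s \<xi>" using omega1_gt_ex by metis
  have "closure_points s \<subseteq> {\<alpha>. limit_ord \<alpha>}"
    using s unfolding closure_points_def limit_ord_def by blast
  moreover have "unbounded (closure_points s)"
    using club_closure_points by (auto simp: club_def)
  ultimately have "unbounded {\<alpha>. limit_ord \<alpha>}" unfolding unbounded_def by blast
  moreover have "order_closed {\<alpha>. limit_ord \<alpha>}"
    unfolding order_closed_def limit_ord_def by blast
  ultimately show ?thesis by (simp add: club_def)
qed

lemma order_closed_gap: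
  assumes "order_closed d" "{..<\<beta>} \<noteq> {}" "\<beta> \<notin> d"
  obtains \<gamma> where "\<gamma> < \<beta>" "\<And>\<delta>. \<delta> \<in> d \<Longrightarrow> \<gamma> < \<delta> \<Longrightarrow> \<not> \<delta> < \<beta>"
  using assms unfolding order_closed_def by blast

text \<open>The witness is the least upper bound of the part of \<open>d\<close> up to
  \<open>\<gamma>\<close>. If it were missing from \<open>d\<close>, it would be a limit of
  \<open>d\<close>, against closedness.\<close>

lemma order_closed_has_max:
  assumes d: "order_closed d" and "\<delta>0 \<in> d" "\<delta>0 \<le> \<gamma>"
  obtains \<delta> where "\<delta> \<in> d" "\<delta> \<le> \<gamma>" "\<And>\<eta>. \<eta> \<in> d \<Longrightarrow> \<eta> \<le> \<gamma> \<Longrightarrow> \<eta> \<le> \<delta>"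
proof -
  let ?ub = "\<lambda>\<delta>. \<forall>\<eta>\<in>d. \<eta> \<le> \<gamma> \<longrightarrow> \<eta> \<le> \<delta>"
  define \<delta> where "\<delta> = (LEAST \<delta>. ?ub \<delta>)"
  have ub: "?ub \<delta>" unfolding \<delta>_def by (rule LeastI[of ?ub \<gamma>]) simp
  have le: "\<delta> \<le> \<gamma>" unfolding \<delta>_def by (rule Least_le) simp
  have "\<delta> \<in> d"
  proof (rule ccontr)
    assume "\<delta> \<notin> d"
    then have "\<delta>0 < \<delta>" using ub assms le_less by blast
    then have "{..<\<delta>} \<noteq> {}" by auto
    moreover have "\<exists>\<eta>\<in>d. \<beta> < \<eta> \<and> \<eta> < \<delta>" if "\<beta> < \<delta>" for \<beta>
    proof -
      have "\<not> ?ub \<beta>" using not_less_Least that unfolding \<delta>_def by blast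
      then obtain \<eta> where "\<eta> \<in> d" "\<eta> \<le> \<gamma>" "\<beta> < \<eta>" by (auto simp: not_le)
      moreover have "\<eta> \<le> \<delta>" "\<eta> \<noteq> \<delta>" using calculation ub \<open>\<delta> \<notin> d\<close> by auto
      ultimately show ?thesis by (metis le_less)
    qed
    ultimately show False using d \<open>\<delta> \<notin> d\<close> unfolding order_closed_def by blast
  qed
  then show ?thesis using that ub le by blast
qed

lemma limit_ord_enumeration:
  assumes "limit_ord \<alpha>"
  obtains e :: "nat \<Rightarrow> omega1" where "range e = {..<\<alpha>}"
  using range_from_nat_into[OF _ countable_lessThan_omega1[of \<alpha>]] assms
  unfolding limit_ord_def by blast

text \<open>This transfers guesses at subsets of \<open>omega1\<close> to guesses at subsets of
  \<open>omega1 \<times> nat\<close>, the codes for sets of nodes.\<close>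

lemma inj_pair_omega1: "\<exists>\<pi> :: omega1 \<times> nat \<Rightarrow> omega1. inj \<pi>"
proof -
  have "infinite (UNIV :: omega1 set)" using uncountable_omega1 countable_finite by blast
  moreover from this have "ordLeq3 (card_of (UNIV :: nat set)) (card_of (UNIV :: omega1 set))"
    by (simp add: infinite_iff_card_of_nat)
  ultimately have "ordIso2 (card_of ((UNIV :: omega1 set) \<times> (UNIV :: nat set))) (card_of (UNIV :: omega1 set))"
    using card_of_Times_infinite[of "UNIV :: omega1 set" "UNIV :: nat set"] by blast
  then show ?thesis
    using card_of_ordLeq[of "(UNIV :: omega1 set) \<times> (UNIV :: nat set)" "UNIV :: omega1 set"]
      ordIso_imp_ordLeq by auto
qed

section \<open>Restrictions of binary sequences\<close>

lemma binseq_restrict_eq: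
  fixes s t :: binseq
  assumes "s \<subseteq>\<^sub>m t" "dom s = {..<\<beta>}"
  shows "t |` {..<\<beta>} = s"
proof
  fix x show "(t |` {..<\<beta>}) x = s x"
  proof (cases "x \<in> dom s")
    case True
    then show ?thesis using assms by (simp add: map_le_def)
  next
    case False
    then have "s x = None" by (simp add: domIff)
    then show ?thesis using False assms(2) by (simp add: restrict_map_def)
  qed
qed

lemma restrict_map_le: "t |` A \<subseteq>\<^sub>m t"
  by (auto simp: map_le_def restrict_map_def)

lemma map_le_SomeD: "m \<subseteq>\<^sub>m v \<Longrightarrow> m x = Some y \<Longrightarrow> v x = Some y"
  unfolding map_le_def by (metis domI)

lemma restrict_agree:
  fixes s t :: binseq
  assumes "s \<subseteq>\<^sub>m t" "dom s = {..<\<gamma>}" "\<delta> \<le> \<gamma>"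
  shows "t |` {..<\<delta>} = s |` {..<\<delta>}"
proof
  fix x show "(t |` {..<\<delta>}) x = (s |` {..<\<delta>}) x"
    using assms by (cases "x < \<delta>") (auto simp: map_le_def)
qed

lemma Int_eq_Int_subset: "A \<inter> S = B \<inter> S \<Longrightarrow> R \<subseteq> S \<Longrightarrow> A \<inter> R = B \<inter> R"
  by (metis Int_assoc inf.absorb2)

section \<open>Requirements on the levels\<close>

text \<open>\<open>\<A>\<close> is meant to guess initial segments of clubs avoiding
  \<open>X\<close>, and \<open>\<S>\<close> to guess coded antichains. Building the levels takes
  only countability; the guessing itself enters when the finished trees are analysed.\<close>

locale guessing =
  fixes \<A> :: "omega1 \<Rightarrow> omega1 set set" and \<S> :: "omega1 \<Rightarrow> (omega1 \<times> nat) set set"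
  assumes countable_A: "countable (\<A> \<alpha>)" and countable_S: "countable (\<S> \<alpha>)"
begin

definition good :: "omega1 set \<Rightarrow> omega1 set \<Rightarrow> bool"
  where "good X d \<longleftrightarrow> order_closed d \<and> (\<forall>\<delta>\<in>d. limit_ord \<delta> \<and> \<delta> \<notin> X \<and> d \<inter> {..<\<delta>} \<in> \<A> \<delta>)"

definition good_upto :: "omega1 set \<Rightarrow> omega1 \<Rightarrow> omega1 set set"
  where "good_upto X \<alpha> = {d. good X d \<and> d \<subseteq> {..\<alpha>} \<and> \<alpha> \<in> d}"

text \<open>A set of nodes is coded by a subset of \<open>\<omega>\<^sub>1 \<times> \<omega>\<close> through fixed enumerations of the levels, so
  that the guesses \<open>\<S>\<close> do not depend on the tree under construction.\<close>

definition decode :: "(omega1 \<Rightarrow> binseq set) \<Rightarrow> omega1 \<Rightarrow> (omega1 \<times> nat) set \<Rightarrow> binseq set"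
  where "decode P \<alpha> Z = {s. \<exists>\<xi> n. \<xi> < \<alpha> \<and> (\<xi>, n) \<in> Z \<and> s = from_nat_into (P \<xi>) n}"

text \<open>\<open>L\<close> is a suitable level \<open>\<alpha>\<close> above the levels \<open>P \<beta>\<close>, \<open>\<beta> < \<alpha>\<close>. In the extension clause, only the
  indices strictly above the given node are asked to be large; the indices at and below it are fixed.\<close>

definition level_ok :: "omega1 set \<Rightarrow> omega1 \<Rightarrow> (omega1 \<Rightarrow> binseq set) \<Rightarrow> binseq set \<Rightarrow> bool"
  where "level_ok X \<alpha> P L \<longleftrightarrow>
    countable L \<and> L \<noteq> {} \<and>
    (\<forall>t\<in>L. dom t = {..<\<alpha>} \<and> (\<forall>\<beta><\<alpha>. t |` {..<\<beta>} \<in> P \<beta>)) \<and>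
    (\<forall>\<beta><\<alpha>. (\<forall>\<gamma>>\<beta>. \<not> \<gamma> < \<alpha>) \<longrightarrow> (\<forall>t\<in>P \<beta>. \<forall>b. t(\<beta> \<mapsto> b) \<in> L)) \<and>
    (\<forall>\<gamma><\<alpha>. \<forall>t\<in>P \<gamma>. \<forall>R N. finite R \<longrightarrow> R \<subseteq> good_upto X \<alpha> \<longrightarrow>
      (\<exists>t'\<in>L. t \<subseteq>\<^sub>m t' \<and>
        (\<forall>d\<in>R. \<forall>\<delta>\<in>d. \<gamma> < \<delta> \<longrightarrow> \<delta> < \<alpha> \<longrightarrow> N \<le> to_nat_on (P \<delta>) (t' |` {..<\<delta>})))) \<and>
    (\<forall>t\<in>L. \<forall>d\<in>good_upto X \<alpha>. \<forall>N.
      finite {\<delta>\<in>d. \<delta> < \<alpha> \<and> to_nat_on (P \<delta>) (t |` {..<\<delta>}) < N}) \<and>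
    (\<alpha> \<in> X \<longrightarrow> limit_ord \<alpha> \<longrightarrow> (\<forall>t\<in>L. \<forall>Z\<in>\<S> \<alpha>. \<exists>\<beta><\<alpha>.
      (\<exists>s\<in>decode P \<alpha> Z. s \<subseteq>\<^sub>m t |` {..<\<beta>}) \<or> (\<forall>s\<in>decode P \<alpha> Z. \<not> t |` {..<\<beta>} \<subseteq>\<^sub>m s)))"

lemma
  assumes "level_ok X \<alpha> P L"
  shows level_ok_countable: "countable L"
    and level_ok_nonempty: "L \<noteq> {}"
    and level_ok_node: "\<forall>t\<in>L. dom t = {..<\<alpha>} \<and> (\<forall>\<beta><\<alpha>. t |` {..<\<beta>} \<in> P \<beta>)"
    and level_ok_split: "\<forall>\<beta><\<alpha>. (\<forall>\<gamma>>\<beta>. \<not> \<gamma> < \<alpha>) \<longrightarrow> (\<forall>t\<in>P \<beta>. \<forall>b. t(\<beta> \<mapsto> b) \<in> L)"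
    and level_ok_extend: "\<forall>\<gamma><\<alpha>. \<forall>t\<in>P \<gamma>. \<forall>R N. finite R \<longrightarrow> R \<subseteq> good_upto X \<alpha> \<longrightarrow> (\<exists>t'\<in>L. t \<subseteq>\<^sub>m t' \<and> (\<forall>d\<in>R. \<forall>\<delta>\<in>d. \<gamma> < \<delta> \<longrightarrow> \<delta> < \<alpha> \<longrightarrow> N \<le> to_nat_on (P \<delta>) (t' |` {..<\<delta>})))"
    and level_ok_index: "\<forall>t\<in>L. \<forall>d\<in>good_upto X \<alpha>. \<forall>N. finite {\<delta>\<in>d. \<delta> < \<alpha> \<and> to_nat_on (P \<delta>) (t |` {..<\<delta>}) < N}"
    and level_ok_seal: "\<alpha> \<in> X \<longrightarrow> limit_ord \<alpha> \<longrightarrow> (\<forall>t\<in>L. \<forall>Z\<in>\<S> \<alpha>. \<exists>\<beta><\<alpha>. (\<exists>s\<in>decode P \<alpha> Z. s \<subseteq>\<^sub>m t |` {..<\<beta>}) \<or> (\<forall>s\<in>decode P \<alpha> Z. \<not> t |` {..<\<beta>} \<subseteq>\<^sub>m s))"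
  using assms unfolding level_ok_def by - (elim conjE, assumption)+

text \<open>Such a \<open>d\<close> is determined by its part below \<open>\<alpha>\<close>, which
  belongs to the countable set \<open>\<A> \<alpha>\<close>.\<close>

lemma countable_good_upto: "countable (good_upto X \<alpha>)"
proof -
  have "good_upto X \<alpha> \<subseteq> insert \<alpha> ` \<A> \<alpha>"
  proof
    fix d assume d: "d \<in> good_upto X \<alpha>"
    then have "d \<inter> {..<\<alpha>} \<in> \<A> \<alpha>" "d = insert \<alpha> (d \<inter> {..<\<alpha>})"
      by (auto simp: good_upto_def good_def le_less)
    then show "d \<in> insert \<alpha> ` \<A> \<alpha>" by blast
  qed
  then show ?thesis using countable_A countable_subset countable_image by metis
qed

text \<open>All demands on indices are therefore vacuous at levels in \<open>X\<close>, where
  branches are sealed, and at non-limit levels.\<close>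

lemma good_upto_empty:
  assumes "\<alpha> \<in> X \<or> \<not> limit_ord \<alpha>"
  shows "good_upto X \<alpha> = {}"
  using assms by (auto simp: good_upto_def good_def)

text \<open>Guessing at \<open>\<delta> \<le> \<beta>\<close> concerns only the part of
  \<open>d\<close> below \<open>\<delta>\<close>, which truncation does not change. Through this
  lemma the clauses of \<open>level_ok\<close> at lower levels apply to initial segments of
  \<open>d\<close>.\<close>

lemma good_Int_atMost:
  assumes "good X d" "\<beta> \<in> d"
  shows "d \<inter> {..\<beta>} \<in> good_upto X \<beta>"
proof -
  have "order_closed (d \<inter> {..\<beta>})"
    unfolding order_closed_def
  proof (intro allI impI)
    fix \<alpha> assume ne: "{..<\<alpha>} \<noteq> {}" and *: "\<forall>b<\<alpha>. \<exists>\<gamma>\<in>d \<inter> {..\<beta>}. b < \<gamma> \<and> \<gamma> < \<alpha>"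
    then have "\<alpha> \<in> d" using assms unfolding good_def order_closed_def by blast
    moreover have "\<alpha> \<le> \<beta>"
      using * by (meson IntD2 atMost_iff not_le)
    ultimately show "\<alpha> \<in> d \<inter> {..\<beta>}" by simp
  qed
  moreover have "d \<inter> {..\<beta>} \<inter> {..<\<delta>} = d \<inter> {..<\<delta>}" if "\<delta> \<le> \<beta>" for \<delta>
    using that by auto
  ultimately show ?thesis using assms by (simp add: good_upto_def good_def)
qed

text \<open>All clauses look only at the levels below \<open>\<alpha>\<close> and at the part of
  \<open>X\<close> up to \<open>\<alpha>\<close>. Both the recursion for the levels and the
  coherence of the trees rest on this.\<close>

lemma level_ok_cong:
  assumes P: "\<And>\<beta>. \<beta> < \<alpha> \<Longrightarrow> P \<beta> = P' \<beta>" and X: "X \<inter> {..\<alpha>} = Y \<inter> {..\<alpha>}"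
  shows "level_ok X \<alpha> P L = level_ok Y \<alpha> P' L"
proof -
  have mem: "\<delta> \<in> X \<longleftrightarrow> \<delta> \<in> Y" if "\<delta> \<le> \<alpha>" for \<delta>
    using X that by blast
  have "good X d \<longleftrightarrow> good Y d" if "d \<subseteq> {..\<alpha>}" for d
    using that mem unfolding good_def by (metis atMost_iff subsetD)
  then have g: "good_upto X \<alpha> = good_upto Y \<alpha>" unfolding good_upto_def by auto
  have dec: "decode P \<alpha> Z = decode P' \<alpha> Z" for Z
    unfolding decode_def by (rule Collect_cong) (metis P)
  have fin: "{\<delta>\<in>d. \<delta> < \<alpha> \<and> to_nat_on (P \<delta>) (t |` {..<\<delta>}) < N}
      = {\<delta>\<in>d. \<delta> < \<alpha> \<and> to_nat_on (P' \<delta>) (t |` {..<\<delta>}) < N}" for d N and t :: binseq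
    using P by auto
  show ?thesis
    unfolding level_ok_def g dec fin using P mem[of \<alpha>] by (simp cong: conj_cong)
qed

end

section \<open>Extending nodes in a tree built up to level \<open>\<kappa>\<close>\<close>

text \<open>This is the induction hypothesis of the recursion; nothing is assumed about
  \<open>P\<close> at \<open>\<kappa>\<close> or above.\<close>

locale partial_tree = guessing +
  fixes X :: "omega1 set" and P :: "omega1 \<Rightarrow> binseq set" and \<kappa> :: omega1
  assumes levels_ok: "\<beta> < \<kappa> \<Longrightarrow> level_ok X \<beta> P (P \<beta>)"
begin

lemma dom_node: "\<beta> < \<kappa> \<Longrightarrow> t \<in> P \<beta> \<Longrightarrow> dom t = {..<\<beta>}"
  by (drule level_ok_node[OF levels_ok]) simp

lemma countable_level: "\<beta> < \<kappa> \<Longrightarrow> countable (P \<beta>)"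
  and level_nonempty: "\<beta> < \<kappa> \<Longrightarrow> P \<beta> \<noteq> {}"
  by (simp_all add: level_ok_countable[OF levels_ok] level_ok_nonempty[OF levels_ok])

lemma restrict_node:
  assumes "\<beta> < \<kappa>" "t \<in> P \<beta>" "\<gamma> \<le> \<beta>"
  shows "t |` {..<\<gamma>} \<in> P \<gamma>"
proof (cases "\<gamma> = \<beta>")
  case True
  then have "t |` {..<\<gamma>} = t" using binseq_restrict_eq[OF map_le_refl dom_node[OF assms(1,2)]] by simp
  then show ?thesis using assms True by simp
next
  case False
  then show ?thesis using assms level_ok_node[OF levels_ok[of \<beta>]] by auto
qed

text \<open>The extension clause with an empty set of demands.\<close>

lemma extend_node:
  assumes "\<beta> < \<kappa>" "\<gamma> \<le> \<beta>" "t \<in> P \<gamma>"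
  obtains t' where "t' \<in> P \<beta>" "t \<subseteq>\<^sub>m t'"
proof (cases "\<gamma> = \<beta>")
  case True
  then show ?thesis using that[of t] assms(3) by simp
next
  case False
  then have "\<gamma> < \<beta>" using assms by auto
  then have "\<exists>t'\<in>P \<beta>. t \<subseteq>\<^sub>m t' \<and>
        (\<forall>d\<in>{}. \<forall>\<delta>\<in>d. \<gamma> < \<delta> \<longrightarrow> \<delta> < \<beta> \<longrightarrow> 0 \<le> to_nat_on (P \<delta>) (t' |` {..<\<delta>}))"
    using assms level_ok_extend[OF levels_ok[OF assms(1)]] by blast
  then show ?thesis using that by blast
qed

text \<open>For each \<open>n\<close> there are \<open>n\<close> such extensions, by induction: of
  the two one-bit extensions of \<open>t\<close>, one has \<open>n\<close> of them and the other
  supplies one more.\<close>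

lemma infinite_extensions:
  assumes \<beta>: "\<beta> < \<kappa>" "limit_ord \<beta>" and R: "finite R" "R \<subseteq> good_upto X \<beta>"
    and \<gamma>: "\<gamma> < \<beta>" "t \<in> P \<gamma>"
  shows "infinite {t'\<in>P \<beta>. t \<subseteq>\<^sub>m t' \<and> (\<forall>d\<in>R. \<forall>\<delta>\<in>d. \<gamma> < \<delta> \<longrightarrow> \<delta> < \<beta> \<longrightarrow>
    N \<le> to_nat_on (P \<delta>) (t' |` {..<\<delta>}))}" (is "infinite (?E \<gamma> t)")
proof
  assume fin: "finite (?E \<gamma> t)"
  have "\<exists>F. finite F \<and> card F = n \<and> F \<subseteq> ?E \<gamma> t" if "\<gamma> < \<beta>" "t \<in> P \<gamma>" for n \<gamma> t
    using that
  proof (induction n arbitrary: \<gamma> t)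
    case 0
    then show ?case by (intro exI[of _ "{}"]) simp
  next
    case (Suc n)
    define \<gamma>' where "\<gamma>' = (LEAST \<gamma>'. \<gamma> < \<gamma>')"
    obtain \<eta> where \<eta>: "\<gamma> < \<eta>" "\<eta> < \<beta>" using \<beta>(2) Suc.prems by (auto simp: limit_ord_def)
    have \<gamma>': "\<gamma> < \<gamma>'" unfolding \<gamma>'_def using \<eta>(1) by (rule LeastI)
    have least: "\<gamma>' \<le> x" if "\<gamma> < x" for x unfolding \<gamma>'_def using that by (rule Least_le)
    have "\<gamma>' < \<beta>" using least[OF \<eta>(1)] \<eta> by auto
    have succ: "t(\<gamma> \<mapsto> b) \<in> P \<gamma>'" for b
    proof -
      have "\<forall>x>\<gamma>. \<not> x < \<gamma>'" using least by (simp add: not_less)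
      moreover have "\<gamma>' < \<kappa>" using \<open>\<gamma>' < \<beta>\<close> \<beta> by auto
      ultimately show ?thesis
        using level_ok_split[OF levels_ok[of \<gamma>']] Suc.prems \<gamma>' by blast
    qed
    have dom_t: "dom t = {..<\<gamma>}" using dom_node[OF less_trans[OF Suc.prems(1) \<beta>(1)] Suc.prems(2)] .
    have t_le: "t \<subseteq>\<^sub>m t(\<gamma> \<mapsto> b)" for b using dom_t by (auto simp: map_le_def)
    \<comment> \<open>Starting from \<open>\<gamma>'\<close> instead of \<open>\<gamma>\<close>
      could lose only the demand at \<open>\<gamma>'\<close> itself, but this is a successor and
      members of good sets are limits.\<close>
    have lift: "?E \<gamma>' (t(\<gamma> \<mapsto> b)) \<subseteq> ?E \<gamma> t" for b
    proof -
      have "\<gamma>' < \<delta>" if "d \<in> R" "\<delta> \<in> d" "\<gamma> < \<delta>" for d \<delta>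
      proof -
        have "limit_ord \<delta>" using R that by (auto simp: good_upto_def good_def)
        then have "\<delta> \<noteq> \<gamma>'" using least \<gamma>' by (auto simp: limit_ord_def not_less[symmetric])
        then show ?thesis using least[OF that(3)] by auto
      qed
      moreover have "t \<subseteq>\<^sub>m v" if "t(\<gamma> \<mapsto> b) \<subseteq>\<^sub>m v" for v
        using t_le that by (rule map_le_trans)
      ultimately show ?thesis by (intro Collect_mono impI) metis
    qed
    obtain F where F: "finite F" "card F = n" "F \<subseteq> ?E \<gamma>' (t(\<gamma> \<mapsto> False))"
      using Suc.IH[OF \<open>\<gamma>' < \<beta>\<close> succ] by blast
    obtain u where u: "u \<in> ?E \<gamma>' (t(\<gamma> \<mapsto> True))"
      using level_ok_extend[OF levels_ok[OF \<beta>(1)], rule_format, OF \<open>\<gamma>' < \<beta>\<close> succ R, of True N]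
      unfolding Bex_def mem_Collect_eq by (elim exE)
    have bit: "v \<gamma> = Some b" if "v \<in> ?E \<gamma>' (t(\<gamma> \<mapsto> b))" for v b
    proof -
      have "t(\<gamma> \<mapsto> b) \<subseteq>\<^sub>m v" using that unfolding mem_Collect_eq by (elim conjE)
      then show ?thesis by (rule map_le_SomeD) simp
    qed
    have "u \<notin> F"
    proof
      assume "u \<in> F"
      then have "u \<gamma> = Some False" using F(3) bit by (meson subsetD)
      then show False using bit[OF u] by simp
    qed
    moreover have "insert u F \<subseteq> ?E \<gamma> t"
      using F(3) u lift[of True] lift[of False] by (meson insert_subset order_trans subsetD)
    ultimately show ?case using F(1,2) by (intro exI[of _ "insert u F"]) simp
  qed
  from this[OF \<gamma>, of "Suc (card (?E \<gamma> t))"] obtain F where F: "card F = Suc (card (?E \<gamma> t))" "F \<subseteq> ?E \<gamma> t"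
    by (elim exE conjE)
  show False using card_mono[OF fin F(2)] F(1) by simp
qed

text \<open>Let \<open>\<delta>\<close> be the last element of \<open>d\<close> up to
  \<open>\<gamma>\<close>. The index clause of level \<open>\<delta>\<close>, applied to
  \<open>d\<close> truncated at \<open>\<delta>\<close>, covers everything below
  \<open>\<delta>\<close>, and \<open>\<delta>\<close> adds one point.\<close>

lemma finite_small_index:
  assumes d: "good X d" and t: "\<gamma> < \<kappa>" "t \<in> P \<gamma>"
  shows "finite {\<delta>\<in>d. \<delta> \<le> \<gamma> \<and> to_nat_on (P \<delta>) (t |` {..<\<delta>}) < N}" (is "finite ?S")
proof (cases "\<exists>\<delta>\<in>d. \<delta> \<le> \<gamma>")
  case False
  then have "?S = {}" by blast
  then show ?thesis by (metis finite.emptyI)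
next
  case True
  then obtain \<delta> where \<delta>: "\<delta> \<in> d" "\<delta> \<le> \<gamma>" "\<And>\<eta>. \<eta> \<in> d \<Longrightarrow> \<eta> \<le> \<gamma> \<Longrightarrow> \<eta> \<le> \<delta>"
    using d order_closed_has_max unfolding good_def by metis
  let ?t = "t |` {..<\<delta>}"
  have "?t \<in> P \<delta>" "\<delta> < \<kappa>" using restrict_node t \<delta> by auto
  then have "finite {\<eta>\<in>d \<inter> {..\<delta>}. \<eta> < \<delta> \<and> to_nat_on (P \<eta>) (?t |` {..<\<eta>}) < N}" (is "finite ?S'")
    using level_ok_index[OF levels_ok[of \<delta>]] good_Int_atMost[OF d \<delta>(1)] by blast
  moreover have "?S \<subseteq> insert \<delta> ?S'"
  proof
    fix \<eta> assume \<eta>: "\<eta> \<in> ?S"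
    then have "\<eta> \<le> \<delta>" using \<delta>(3) by blast
    moreover have "?t |` {..<\<eta>} = t |` {..<\<eta>}" if "\<eta> \<le> \<delta>"
      using that by (simp add: inf.absorb2)
    ultimately show "\<eta> \<in> insert \<delta> ?S'" using \<eta> by (auto simp: le_less)
  qed
  ultimately show ?thesis using finite_subset by blast
qed

text \<open>At levels \<open>\<beta> \<in> d\<close> a large index is available because a node has infinitely many suitable
  extensions; the sets \<open>d\<close> not containing \<open>\<beta>\<close> are bounded below \<open>\<beta>\<close> and are dealt with first.\<close>

lemma extend_large_index:
  assumes "\<beta> < \<kappa>" "\<alpha> \<le> \<beta>" "t \<in> P \<alpha>" and D: "finite D" "\<And>d. d \<in> D \<Longrightarrow> good X d"
  shows "\<exists>t'\<in>P \<beta>. t \<subseteq>\<^sub>m t' \<and> (\<forall>d\<in>D. \<forall>\<delta>\<in>d. \<alpha> < \<delta> \<longrightarrow> \<delta> \<le> \<beta> \<longrightarrow>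
    N \<le> to_nat_on (P \<delta>) (t' |` {..<\<delta>}))"
  using assms(1-3)
proof (induction \<beta> rule: less_induct)
  case (less \<beta>)
  show ?case
  proof (cases "\<alpha> = \<beta>")
    case True
    then show ?thesis using less.prems by (intro bexI[of _ t]) auto
  next
    case False
    then have "\<alpha> < \<beta>" using less.prems by auto
    then have ne: "{..<\<beta>} \<noteq> {}" by blast
    have "\<exists>\<gamma><\<beta>. \<forall>\<delta>\<in>d. \<gamma> < \<delta> \<longrightarrow> \<not> \<delta> < \<beta>" if "d \<in> D" "\<beta> \<notin> d" for d
      using order_closed_gap[OF _ ne that(2)] D(2)[OF that(1)] unfolding good_def by metis
    then obtain g where g: "\<And>d. d \<in> D \<Longrightarrow> \<beta> \<notin> d \<Longrightarrow> g d < \<beta> \<and> (\<forall>\<delta>\<in>d. g d < \<delta> \<longrightarrow> \<not> \<delta> < \<beta>)"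
      by metis
    \<comment> \<open>The maximum \<open>\<gamma>\<close> lies above the bounds of all
      \<open>d\<close> that miss \<open>\<beta>\<close>; strictly between \<open>\<gamma>\<close>
      and \<open>\<beta>\<close> only the \<open>d\<close> containing \<open>\<beta>\<close> have
      elements.\<close>
    define G where "G = insert \<alpha> (g ` {d\<in>D. \<beta> \<notin> d})"
    define \<gamma> where "\<gamma> = Max G"
    have G: "finite G" "G \<noteq> {}" using D by (auto simp: G_def)
    have "\<gamma> \<in> G" unfolding \<gamma>_def using G by (rule Max_in)
    then have "\<gamma> < \<beta>" using g \<open>\<alpha> < \<beta>\<close> by (auto simp: G_def)
    have G_le: "x \<le> \<gamma>" if "x \<in> G" for x unfolding \<gamma>_def using G that by simp
    have "\<alpha> \<le> \<gamma>" using G_le by (simp add: G_def)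
    have gap: "\<not> \<delta> < \<beta>" if "d \<in> D" "\<beta> \<notin> d" "\<delta> \<in> d" "\<gamma> < \<delta>" for d \<delta>
    proof -
      have "g d \<le> \<gamma>" using G_le that by (simp add: G_def)
      then show ?thesis using g that by (meson le_less_trans)
    qed
    obtain u where u: "u \<in> P \<gamma>" "t \<subseteq>\<^sub>m u"
      "\<And>d \<delta>. d \<in> D \<Longrightarrow> \<delta> \<in> d \<Longrightarrow> \<alpha> < \<delta> \<Longrightarrow> \<delta> \<le> \<gamma> \<Longrightarrow> N \<le> to_nat_on (P \<delta>) (u |` {..<\<delta>})"
      using less.IH[OF \<open>\<gamma> < \<beta>\<close> less_trans[OF \<open>\<gamma> < \<beta>\<close> less.prems(1)] \<open>\<alpha> \<le> \<gamma>\<close> less.prems(3)]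
      by (elim bexE conjE) simp
    have dom_u: "dom u = {..<\<gamma>}" using dom_node[OF less_trans[OF \<open>\<gamma> < \<beta>\<close> less.prems(1)] u(1)] .
    have low: "N \<le> to_nat_on (P \<delta>) (t' |` {..<\<delta>})"
      if "u \<subseteq>\<^sub>m t'" "d \<in> D" "\<delta> \<in> d" "\<alpha> < \<delta>" "\<delta> \<le> \<gamma>" for t' d \<delta>
      using u(3) that restrict_agree[OF that(1) dom_u] by simp
    let ?D1 = "{d\<in>D. \<beta> \<in> d}"
    show ?thesis
    proof (cases "?D1 = {}")
      case True
      obtain t' where t': "t' \<in> P \<beta>" "u \<subseteq>\<^sub>m t'"
        using extend_node[OF less.prems(1) less_imp_le[OF \<open>\<gamma> < \<beta>\<close>] u(1)] .
      have "N \<le> to_nat_on (P \<delta>) (t' |` {..<\<delta>})" if "d \<in> D" "\<delta> \<in> d" "\<alpha> < \<delta>" "\<delta> \<le> \<beta>" for d \<delta>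
      proof -
        have "\<beta> \<notin> d" using True that(1) by blast
        then have "\<delta> \<le> \<gamma>" using gap[OF that(1) _ that(2)] that(2,4) by (metis le_less not_le)
        then show ?thesis using low[OF t'(2) that(1-3)] by simp
      qed
      then show ?thesis using t'(1) map_le_trans[OF u(2) t'(2)] by (intro bexI[of _ t'] conjI ballI impI)
    next
      case False
      \<comment> \<open>Truncating at \<open>\<beta>\<close> turns the remaining sets into members
        of \<open>good_upto X \<beta>\<close>.\<close>
      let ?R = "(\<lambda>d. d \<inter> {..\<beta>}) ` ?D1"
      let ?E = "{t'\<in>P \<beta>. u \<subseteq>\<^sub>m t' \<and> (\<forall>d\<in>?R. \<forall>\<delta>\<in>d. \<gamma> < \<delta> \<longrightarrow> \<delta> < \<beta> \<longrightarrow>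
        N \<le> to_nat_on (P \<delta>) (t' |` {..<\<delta>}))}"
      have "limit_ord \<beta>" using False D by (auto simp: good_def)
      moreover have "finite ?R" "?R \<subseteq> good_upto X \<beta>" using D good_Int_atMost by auto
      ultimately have "infinite ?E"
        using infinite_extensions[OF less.prems(1) _ _ _ \<open>\<gamma> < \<beta>\<close> u(1)] by blast
      \<comment> \<open>Different nodes of level \<open>\<beta>\<close> have different indices, so
        one of infinitely many extensions has index at least \<open>N\<close> at
        \<open>\<beta>\<close> too.\<close>
      moreover have "inj_on (to_nat_on (P \<beta>)) ?E"
        by (rule inj_on_subset[OF inj_on_to_nat_on[OF countable_level[OF less.prems(1)]]]) blast
      ultimately have "infinite (to_nat_on (P \<beta>) ` ?E)" using finite_imageD by blast
      then obtain m where "m \<ge> N" "m \<in> to_nat_on (P \<beta>) ` ?E"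
        using infinite_nat_iff_unbounded_le by blast
      then obtain t' where t': "t' \<in> ?E" "N \<le> to_nat_on (P \<beta>) t'" by blast
      have "t' |` {..<\<beta>} = t'"
        using binseq_restrict_eq[of t' t' \<beta>] dom_node[of \<beta> t'] less.prems(1) t'(1) by auto
      have "N \<le> to_nat_on (P \<delta>) (t' |` {..<\<delta>})" if d: "d \<in> D" "\<delta> \<in> d" "\<alpha> < \<delta>" "\<delta> \<le> \<beta>" for d \<delta>
      proof -
        consider "\<delta> \<le> \<gamma>" | "\<delta> = \<beta>" | "\<gamma> < \<delta>" "\<delta> < \<beta>" using d by fastforce
        then show ?thesis
        proof cases
          case 1
          then show ?thesis using low[OF _ d(1-3)] t'(1) by simp
        next
          case 2
          then show ?thesis using t' \<open>t' |` {..<\<beta>} = t'\<close> by simp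
        next
          case 3
          then have "\<beta> \<in> d" using gap d by blast
          then show ?thesis using t'(1) d 3 by auto
        qed
      qed
      moreover have "t' \<in> P \<beta>" "u \<subseteq>\<^sub>m t'" using t'(1) by simp_all
      ultimately show ?thesis using map_le_trans[OF u(2)] by (intro bexI[of _ t'] conjI ballI impI)
    qed
  qed
qed

end

section \<open>Construction of the next level\<close>

context partial_tree
begin

text \<open>The common scheme for both kinds of limit levels: step \<open>n\<close> climbs past the
  \<open>n\<close>-th element of an enumeration of the ordinals below \<open>\<kappa>\<close> and
  meets the \<open>n\<close>-th requirement \<open>Q n\<close>; the branch is the union of the
  chosen nodes.\<close>

lemma branch_exists:
  assumes lim: "limit_ord \<kappa>" and \<gamma>0: "\<gamma>0 < \<kappa>" "t0 \<in> P \<gamma>0"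
    and step: "\<forall>n. \<forall>\<gamma><\<kappa>. \<forall>t\<in>P \<gamma>. \<forall>\<epsilon><\<kappa>.
      \<exists>\<gamma>' t'. \<gamma>' < \<kappa> \<and> \<gamma> < \<gamma>' \<and> \<epsilon> < \<gamma>' \<and> t' \<in> P \<gamma>' \<and> t \<subseteq>\<^sub>m t' \<and> Q n \<gamma> \<gamma>' t'"
  obtains b and g :: "nat \<Rightarrow> omega1"
  where "dom b = {..<\<kappa>}" "\<forall>\<beta><\<kappa>. b |` {..<\<beta>} \<in> P \<beta>" "t0 \<subseteq>\<^sub>m b"
    "g 0 = \<gamma>0" "\<forall>n. g n < \<kappa>" "\<forall>n. g n < g (Suc n)" "\<forall>\<beta><\<kappa>. \<exists>n. \<beta> < g n"
    "\<forall>n. Q n (g n) (g (Suc n)) (b |` {..<g (Suc n)})"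
proof -
  obtain e :: "nat \<Rightarrow> omega1" where e: "range e = {..<\<kappa>}" using limit_ord_enumeration[OF lim] .
  have e_less: "e n < \<kappa>" for n using e by blast
  \<comment> \<open>Dependent choice of pairs of a height and a node; the clause for
    \<open>n = 0\<close> pins the starting pair.\<close>
  have "\<exists>f. \<forall>n. (fst (f n) < \<kappa> \<and> snd (f n) \<in> P (fst (f n)) \<and> (n = 0 \<longrightarrow> f n = (\<gamma>0, t0))) \<and>
    (fst (f n) < fst (f (Suc n)) \<and> e n < fst (f (Suc n)) \<and> snd (f n) \<subseteq>\<^sub>m snd (f (Suc n))
      \<and> Q n (fst (f n)) (fst (f (Suc n))) (snd (f (Suc n))))"
  proof (rule dependent_nat_choice)
    show "\<exists>x. fst x < \<kappa> \<and> snd x \<in> P (fst x) \<and> ((0::nat) = 0 \<longrightarrow> x = (\<gamma>0, t0))"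
      using \<gamma>0 by (intro exI[of _ "(\<gamma>0, t0)"]) simp
    fix x and n :: nat
    assume "fst x < \<kappa> \<and> snd x \<in> P (fst x) \<and> (n = 0 \<longrightarrow> x = (\<gamma>0, t0))"
    then have x: "fst x < \<kappa>" "snd x \<in> P (fst x)" by simp_all
    obtain \<gamma>' t' where "\<gamma>' < \<kappa> \<and> fst x < \<gamma>' \<and> e n < \<gamma>' \<and> t' \<in> P \<gamma>' \<and> snd x \<subseteq>\<^sub>m t' \<and> Q n (fst x) \<gamma>' t'"
      using step[rule_format, OF x e_less, of n n] by (elim exE)
    then show "\<exists>y. (fst y < \<kappa> \<and> snd y \<in> P (fst y) \<and> (Suc n = 0 \<longrightarrow> y = (\<gamma>0, t0))) \<and>
      fst x < fst y \<and> e n < fst y \<and> snd x \<subseteq>\<^sub>m snd y \<and> Q n (fst x) (fst y) (snd y)"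
      by (intro exI[of _ "(\<gamma>', t')"]) simp
  qed
  then obtain f where F: "\<forall>n. (fst (f n) < \<kappa> \<and> snd (f n) \<in> P (fst (f n)) \<and> (n = 0 \<longrightarrow> f n = (\<gamma>0, t0))) \<and>
    (fst (f n) < fst (f (Suc n)) \<and> e n < fst (f (Suc n)) \<and> snd (f n) \<subseteq>\<^sub>m snd (f (Suc n))
      \<and> Q n (fst (f n)) (fst (f (Suc n))) (snd (f (Suc n))))" by (rule exE)
  have f: "fst (f n) < \<kappa>" "snd (f n) \<in> P (fst (f n))"
      "fst (f n) < fst (f (Suc n))" "e n < fst (f (Suc n))" "snd (f n) \<subseteq>\<^sub>m snd (f (Suc n))"
      "Q n (fst (f n)) (fst (f (Suc n))) (snd (f (Suc n)))" for n
    using spec[OF F, of n] by - (elim conjE, assumption)+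
  have f0: "f 0 = (\<gamma>0, t0)" using spec[OF F, of 0] by (elim conjE) simp
  define g t where "g n = fst (f n)" and "t n = snd (f n)" for n
  note f = f[folded g_def t_def]
  have dom_t: "dom (t n) = {..<g n}" for n using dom_node[OF f(1,2)] .
  have mono: "t m \<subseteq>\<^sub>m t n" if "m \<le> n" for m n
    using that
  proof (induction n rule: dec_induct)
    case base
    show ?case by simp
  next
    case (step n)
    show ?case using step.IH f(5) by (rule map_le_trans)
  qed
  have comp: "t m x = t n x" if "x < g m" "x < g n" for m n x
  proof (cases "m \<le> n")
    case True
    have "x \<in> dom (t m)" unfolding dom_t using that(1) by simp
    then show ?thesis using mono[OF True, unfolded map_le_def] by (rule bspec[rotated])
  next
    case False
    then have "n \<le> m" by simp
    have "x \<in> dom (t n)" unfolding dom_t using that(2) by simp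
    then show ?thesis using mono[OF \<open>n \<le> m\<close>, unfolded map_le_def] bspec by metis
  qed
  have cof: "\<exists>n. \<beta> < g n" if "\<beta> < \<kappa>" for \<beta>
  proof -
    have "\<beta> \<in> range e" using that e by simp
    then obtain n where "\<beta> = e n" by (rule rangeE)
    then show ?thesis using f(4)[of n] by (intro exI[of _ "Suc n"]) simp
  qed
  \<comment> \<open>By \<open>comp\<close> the value does not depend on which \<open>n\<close> is
    chosen.\<close>
  define b where "b x = (if \<exists>n. x < g n then t (SOME n. x < g n) x else None)" for x
  have b_eq: "b x = t n x" if "x < g n" for n x
  proof -
    have "x < g (SOME n. x < g n)" using that by (rule someI)
    then have "t (SOME n. x < g n) x = t n x" using that by (rule comp)
    then show ?thesis unfolding b_def using that by auto
  qed
  have t_le: "t n \<subseteq>\<^sub>m b" for n unfolding map_le_def using b_eq dom_t by auto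
  have restr: "b |` {..<g n} = t n" for n using binseq_restrict_eq[OF t_le dom_t] .
  have dom_b: "dom b = {..<\<kappa>}"
  proof (intro equalityI subsetI)
    fix x assume "x \<in> dom b"
    then obtain n where "x < g n" unfolding b_def by (auto split: if_splits)
    then show "x \<in> {..<\<kappa>}" using f(1)[of n] by auto
  next
    fix x assume "x \<in> {..<\<kappa>}"
    then obtain n where "x < g n" using cof by auto
    then have "x \<in> dom (t n)" using dom_t by simp
    then show "x \<in> dom b" using b_eq[OF \<open>x < g n\<close>] by auto
  qed
  have nodes: "b |` {..<\<beta>} \<in> P \<beta>" if \<beta>: "\<beta> < \<kappa>" for \<beta>
  proof -
    obtain n where n: "\<beta> < g n" using cof[OF \<beta>] by blast
    have "t n |` {..<\<beta>} \<in> P \<beta>" using restrict_node[OF f(1,2)] n by simp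
    then show ?thesis using restrict_agree[OF t_le dom_t less_imp_le[OF n]] by simp
  qed
  have "t0 \<subseteq>\<^sub>m b" using t_le[of 0] f0 by (simp add: t_def)
  moreover have "g 0 = \<gamma>0" using f0 by (simp add: g_def)
  moreover have "\<forall>n. Q n (g n) (g (Suc n)) (b |` {..<g (Suc n)})" unfolding restr using f(6) by (rule allI)
  ultimately show ?thesis using that[of b g] dom_b nodes f(1,3) cof by simp
qed

text \<open>Step \<open>n\<close> handles the \<open>n\<close>-th guess: the node is extended above
  an element of the decoded set if it lies below one, and otherwise no extension of it can lie below
  one.\<close>

lemma sealing_branch:
  assumes lim: "limit_ord \<kappa>" and \<gamma>0: "\<gamma>0 < \<kappa>" "t0 \<in> P \<gamma>0"
  shows "\<exists>b. dom b = {..<\<kappa>} \<and> (\<forall>\<beta><\<kappa>. b |` {..<\<beta>} \<in> P \<beta>) \<and> t0 \<subseteq>\<^sub>m b \<and>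
    (\<forall>Z\<in>\<S> \<kappa>. \<exists>\<beta><\<kappa>. (\<exists>s\<in>decode P \<kappa> Z. s \<subseteq>\<^sub>m b |` {..<\<beta>}) \<or>
      (\<forall>s\<in>decode P \<kappa> Z. \<not> b |` {..<\<beta>} \<subseteq>\<^sub>m s))"
proof -
  \<comment> \<open>If \<open>\<S> \<kappa>\<close> is empty, the default value of
    \<open>from_nat_into\<close> merely adds a requirement that can be met like any other.\<close>
  let ?D = "\<lambda>n. decode P \<kappa> (from_nat_into (\<S> \<kappa>) n)"
  let ?Q = "\<lambda>n (\<gamma>::omega1) (\<gamma>'::omega1) t'. (\<exists>s\<in>?D n. s \<subseteq>\<^sub>m t') \<or> (\<forall>s\<in>?D n. \<not> t' \<subseteq>\<^sub>m s)"
  have step: "\<forall>n. \<forall>\<gamma><\<kappa>. \<forall>t\<in>P \<gamma>. \<forall>\<epsilon><\<kappa>.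
    \<exists>\<gamma>' t'. \<gamma>' < \<kappa> \<and> \<gamma> < \<gamma>' \<and> \<epsilon> < \<gamma>' \<and> t' \<in> P \<gamma>' \<and> t \<subseteq>\<^sub>m t' \<and> ?Q n \<gamma> \<gamma>' t'"
  proof (intro allI impI ballI)
    fix n \<gamma> t \<epsilon> assume \<gamma>: "\<gamma> < \<kappa>" "t \<in> P \<gamma>" "\<epsilon> < \<kappa>"
    show "\<exists>\<gamma>' t'. \<gamma>' < \<kappa> \<and> \<gamma> < \<gamma>' \<and> \<epsilon> < \<gamma>' \<and> t' \<in> P \<gamma>' \<and> t \<subseteq>\<^sub>m t' \<and> ?Q n \<gamma> \<gamma>' t'"
    proof (cases "\<exists>s\<in>?D n. t \<subseteq>\<^sub>m s")
      case True
      then obtain \<xi> s m where s: "s \<in> ?D n" "t \<subseteq>\<^sub>m s" "\<xi> < \<kappa>" "s = from_nat_into (P \<xi>) m"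
        unfolding decode_def by blast
      have "s \<in> P \<xi>" using s(4) from_nat_into[OF level_nonempty[OF s(3)]] by simp
      \<comment> \<open>Including \<open>\<xi>\<close> allows the next node to be chosen above
        \<open>s\<close>.\<close>
      have "max (max \<gamma> \<epsilon>) \<xi> < \<kappa>" using \<gamma> s(3) by simp
      then obtain \<gamma>' where \<gamma>': "max (max \<gamma> \<epsilon>) \<xi> < \<gamma>'" "\<gamma>' < \<kappa>"
        using lim unfolding limit_ord_def by blast
      then obtain t' where t': "t' \<in> P \<gamma>'" "s \<subseteq>\<^sub>m t'"
        using extend_node[OF \<gamma>'(2) _ \<open>s \<in> P \<xi>\<close>] by (metis less_imp_le max_less_iff_conj)
      then show ?thesis using \<gamma>' s(1) map_le_trans[OF s(2)] by (intro exI[of _ \<gamma>'] exI[of _ t']) auto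
    next
      case False
      have "max \<gamma> \<epsilon> < \<kappa>" using \<gamma> by simp
      then obtain \<gamma>' where \<gamma>': "max \<gamma> \<epsilon> < \<gamma>'" "\<gamma>' < \<kappa>"
        using lim unfolding limit_ord_def by blast
      then obtain t' where t': "t' \<in> P \<gamma>'" "t \<subseteq>\<^sub>m t'"
        using extend_node[OF \<gamma>'(2) _ \<gamma>(2)] by (metis less_imp_le max_less_iff_conj)
      have "\<forall>s\<in>?D n. \<not> t' \<subseteq>\<^sub>m s" using False map_le_trans[OF t'(2)] by blast
      then show ?thesis using \<gamma>' t' by (intro exI[of _ \<gamma>'] exI[of _ t']) auto
    qed
  qed
  obtain b g where b: "dom b = {..<\<kappa>}" "\<forall>\<beta><\<kappa>. b |` {..<\<beta>} \<in> P \<beta>" "t0 \<subseteq>\<^sub>m b"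
    and g: "g 0 = \<gamma>0" "\<forall>n. g n < \<kappa>" "\<forall>n. g n < g (Suc n)" "\<forall>\<beta><\<kappa>. \<exists>n. \<beta> < g n"
      "\<forall>n. ?Q n (g n) (g (Suc n)) (b |` {..<g (Suc n)})"
    by (rule branch_exists[where Q = ?Q, OF lim \<gamma>0 step]) (rule that)
  note b = b[rule_format] and g = g(1) g(2-4)[rule_format] g(5)[THEN spec]
  have "\<exists>\<beta><\<kappa>. (\<exists>s\<in>decode P \<kappa> Z. s \<subseteq>\<^sub>m b |` {..<\<beta>}) \<or> (\<forall>s\<in>decode P \<kappa> Z. \<not> b |` {..<\<beta>} \<subseteq>\<^sub>m s)"
    if Z: "Z \<in> \<S> \<kappa>" for Z
  proof -
    obtain n where n: "from_nat_into (\<S> \<kappa>) n = Z" using from_nat_into_surj[OF countable_S Z] by blast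
    show ?thesis using g(2)[of "Suc n"] g(5)[of n, unfolded n] by blast
  qed
  then show ?thesis using b by (intro exI[of _ b]) simp
qed

text \<open>Step \<open>n\<close> makes all indices on its interval large for the first
  \<open>n + 1\<close> good sets. For any one good set, indices below a bound \<open>M\<close> thus
  occur only up to some height below \<open>\<kappa>\<close>, and there
  \<open>finite_small_index\<close> applies.\<close>

lemma specializing_branch:
  assumes lim: "limit_ord \<kappa>" and \<gamma>0: "\<gamma>0 < \<kappa>" "t0 \<in> P \<gamma>0"
    and R: "finite R" "R \<subseteq> good_upto X \<kappa>"
  shows "\<exists>b. dom b = {..<\<kappa>} \<and> (\<forall>\<beta><\<kappa>. b |` {..<\<beta>} \<in> P \<beta>) \<and> t0 \<subseteq>\<^sub>m b \<and>
    (\<forall>d\<in>R. \<forall>\<delta>\<in>d. \<gamma>0 < \<delta> \<longrightarrow> \<delta> < \<kappa> \<longrightarrow> N \<le> to_nat_on (P \<delta>) (b |` {..<\<delta>})) \<and>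
    (\<forall>d\<in>good_upto X \<kappa>. \<forall>M. finite {\<delta>\<in>d. \<delta> < \<kappa> \<and> to_nat_on (P \<delta>) (b |` {..<\<delta>}) < M})"
proof -
  \<comment> \<open>The intersection discards the default value of \<open>from_nat_into\<close> when
    there are no good sets.\<close>
  define D where "D n = R \<union> (from_nat_into (good_upto X \<kappa>) ` {..n} \<inter> good_upto X \<kappa>)" for n
  have D: "finite (D n)" "d \<in> D n \<Longrightarrow> good X d" for n d
    using R by (auto simp: D_def good_upto_def)
  \<comment> \<open>In \<open>N + n\<close>, the summand \<open>N\<close> serves the demand on
    \<open>R\<close> and the growing \<open>n\<close> serves finiteness.\<close>
  let ?Q = "\<lambda>n \<gamma> \<gamma>' t'. \<forall>d\<in>D n. \<forall>\<delta>\<in>d. \<gamma> < \<delta> \<longrightarrow> \<delta> \<le> \<gamma>' \<longrightarrow> N + n \<le> to_nat_on (P \<delta>) (t' |` {..<\<delta>})"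
  have step: "\<forall>n. \<forall>\<gamma><\<kappa>. \<forall>t\<in>P \<gamma>. \<forall>\<epsilon><\<kappa>.
    \<exists>\<gamma>' t'. \<gamma>' < \<kappa> \<and> \<gamma> < \<gamma>' \<and> \<epsilon> < \<gamma>' \<and> t' \<in> P \<gamma>' \<and> t \<subseteq>\<^sub>m t' \<and> ?Q n \<gamma> \<gamma>' t'"
  proof (intro allI impI ballI)
    fix n \<gamma> t \<epsilon> assume \<gamma>: "\<gamma> < \<kappa>" "t \<in> P \<gamma>" "\<epsilon> < \<kappa>"
    show "\<exists>\<gamma>' t'. \<gamma>' < \<kappa> \<and> \<gamma> < \<gamma>' \<and> \<epsilon> < \<gamma>' \<and> t' \<in> P \<gamma>' \<and> t \<subseteq>\<^sub>m t' \<and> ?Q n \<gamma> \<gamma>' t'"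
    proof -
      have "max \<gamma> \<epsilon> < \<kappa>" using \<gamma> by simp
      then obtain \<gamma>' where \<gamma>': "max \<gamma> \<epsilon> < \<gamma>'" "\<gamma>' < \<kappa>"
        using lim unfolding limit_ord_def by blast
      then have less: "\<gamma> < \<gamma>'" "\<epsilon> < \<gamma>'" by simp_all
      obtain t' where "t' \<in> P \<gamma>'" "t \<subseteq>\<^sub>m t' \<and> ?Q n \<gamma> \<gamma>' t'"
        using extend_large_index[OF \<gamma>'(2) less_imp_le[OF less(1)] \<gamma>(2) D(1)[of n] D(2), where N = "N + n"]
        by (rule bexE)
      then show ?thesis using less \<gamma>'(2) by (intro exI[of _ \<gamma>'] exI[of _ t']) simp
    qed
  qed
  obtain b g where b: "dom b = {..<\<kappa>}" "\<forall>\<beta><\<kappa>. b |` {..<\<beta>} \<in> P \<beta>" "t0 \<subseteq>\<^sub>m b"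
    and g: "g 0 = \<gamma>0" "\<forall>n. g n < \<kappa>" "\<forall>n. g n < g (Suc n)" "\<forall>\<beta><\<kappa>. \<exists>n. \<beta> < g n"
      "\<forall>n. ?Q n (g n) (g (Suc n)) (b |` {..<g (Suc n)})"
    by (rule branch_exists[where Q = ?Q, OF lim \<gamma>0 step]) (rule that)
  note b = b[rule_format] and g = g(1) g(2-4)[rule_format] g(5)[THEN spec]
  have large: "N + m \<le> to_nat_on (P \<delta>) (b |` {..<\<delta>})"
    if d: "d \<in> D m" "\<delta> \<in> d" "g m < \<delta>" "\<delta> < \<kappa>" for d \<delta> m
  proof -
    obtain k where k: "\<delta> \<le> g k" using g(4)[OF d(4)] less_imp_le by blast
    \<comment> \<open>The index at \<open>\<delta>\<close> was fixed in the step whose interval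
      contains \<open>\<delta>\<close>, the one leading to this least \<open>g n\<close>.\<close>
    define n where "n = (LEAST n. \<delta> \<le> g n)"
    have n: "\<delta> \<le> g n" unfolding n_def using k by (rule LeastI)
    have g_mono: "g i \<le> g j" if "i \<le> j" for i j
      using lift_Suc_mono_le[of g, OF less_imp_le[OF g(3)] that] .
    have "m < n" using n d(3) g_mono[of n m] by (meson leD le_less_trans not_le_imp_less order_trans)
    then obtain i where i: "n = Suc i" "m \<le> i" by (cases n) auto
    have "g i < \<delta>" using not_less_Least[of i "\<lambda>n. \<delta> \<le> g n"] i n_def by (metis lessI not_le)
    moreover have "d \<in> D i" using d(1) i(2) by (auto simp: D_def)
    ultimately have "N + i \<le> to_nat_on (P \<delta>) (b |` {..<g (Suc i)} |` {..<\<delta>})"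
      using g(5)[of i] d(2) n i(1) by blast
    moreover have "b |` {..<g (Suc i)} |` {..<\<delta>} = b |` {..<\<delta>}"
      using n i(1) by (simp add: inf.absorb2)
    ultimately show ?thesis using i(2) by simp
  qed
  have fin: "finite {\<delta>\<in>d. \<delta> < \<kappa> \<and> to_nat_on (P \<delta>) (b |` {..<\<delta>}) < M}" (is "finite ?S")
    if d: "d \<in> good_upto X \<kappa>" for d M
  proof -
    obtain k where k: "from_nat_into (good_upto X \<kappa>) k = d"
      using from_nat_into_surj[OF countable_good_upto d] by blast
    \<comment> \<open>From step \<open>m\<close> on, \<open>d\<close> is under control and the bound
      on the indices is at least \<open>M\<close>.\<close>
    define m where "m = max k M"
    have "d \<in> D m" using k d unfolding D_def m_def by (auto intro!: image_eqI[of d _ k])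
    let ?b = "b |` {..<g m}"
    have "finite {\<delta>\<in>d. \<delta> \<le> g m \<and> to_nat_on (P \<delta>) (?b |` {..<\<delta>}) < M}" (is "finite ?S'")
      using finite_small_index[of d "g m" ?b M] g(2) b(2) d by (simp add: good_upto_def)
    moreover have "?S \<subseteq> ?S'"
    proof
      fix \<delta> assume \<delta>: "\<delta> \<in> ?S"
      have "\<delta> \<le> g m"
      proof (rule ccontr)
        assume "\<not> \<delta> \<le> g m"
        then have "N + m \<le> to_nat_on (P \<delta>) (b |` {..<\<delta>})"
          using large[OF \<open>d \<in> D m\<close>] \<delta> by simp
        moreover have "M \<le> m" unfolding m_def by simp
        ultimately show False using \<delta> by simp
      qed
      moreover from this have "?b |` {..<\<delta>} = b |` {..<\<delta>}" by (simp add: inf.absorb2)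
      ultimately show "\<delta> \<in> ?S'" using \<delta> by simp
    qed
    ultimately show ?thesis using finite_subset by blast
  qed
  have "N \<le> to_nat_on (P \<delta>) (b |` {..<\<delta>})" if "d \<in> R" "\<delta> \<in> d" "\<gamma>0 < \<delta>" "\<delta> < \<kappa>" for d \<delta>
    using large[of d 0 \<delta>] that g(1) by (simp add: D_def)
  then show ?thesis using b fin by (intro exI[of _ b]) simp
qed

text \<open>One branch is taken for each instance \<open>(\<gamma>, t, R, N)\<close> of the
  extension clause, and there are only countably many. For \<open>\<kappa> \<in> X\<close> the index
  demands are vacuous, for \<open>\<kappa> \<notin> X\<close> the sealing demands are.\<close>

lemma limit_level_exists:
  assumes lim: "limit_ord \<kappa>"
  shows "\<exists>L. level_ok X \<kappa> P L"
proof -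
  define nice where "nice \<gamma> t R N b \<longleftrightarrow> dom b = {..<\<kappa>} \<and> (\<forall>\<beta><\<kappa>. b |` {..<\<beta>} \<in> P \<beta>) \<and> t \<subseteq>\<^sub>m b \<and>
    (\<forall>d\<in>R. \<forall>\<delta>\<in>d. \<gamma> < \<delta> \<longrightarrow> \<delta> < \<kappa> \<longrightarrow> N \<le> to_nat_on (P \<delta>) (b |` {..<\<delta>})) \<and>
    (\<forall>d\<in>good_upto X \<kappa>. \<forall>M. finite {\<delta>\<in>d. \<delta> < \<kappa> \<and> to_nat_on (P \<delta>) (b |` {..<\<delta>}) < M}) \<and>
    (\<kappa> \<in> X \<longrightarrow> (\<forall>Z\<in>\<S> \<kappa>. \<exists>\<beta><\<kappa>. (\<exists>s\<in>decode P \<kappa> Z. s \<subseteq>\<^sub>m b |` {..<\<beta>}) \<or>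
      (\<forall>s\<in>decode P \<kappa> Z. \<not> b |` {..<\<beta>} \<subseteq>\<^sub>m s)))" for \<gamma> t R N b
  have nice_ex: "\<exists>b. nice \<gamma> t R N b" if "\<gamma> < \<kappa>" "t \<in> P \<gamma>" "finite R" "R \<subseteq> good_upto X \<kappa>" for \<gamma> t R N
  proof (cases "\<kappa> \<in> X")
    case True
    then have "good_upto X \<kappa> = {}" by (simp add: good_upto_empty)
    then show ?thesis using sealing_branch[OF lim that(1,2)] that(4) True unfolding nice_def by simp
  next
    case False
    then show ?thesis using specializing_branch[OF lim that, of N] unfolding nice_def by simp
  qed
  define br where "br \<gamma> t R N = (SOME b. nice \<gamma> t R N b)" for \<gamma> t R N
  define I where "I = (SIGMA \<gamma>:{..<\<kappa>}. P \<gamma> \<times> {R. finite R \<and> R \<subseteq> good_upto X \<kappa>} \<times> (UNIV :: nat set))"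
  define L where "L = (\<lambda>(\<gamma>, t, R, N). br \<gamma> t R N) ` I"
  have nice_br: "nice \<gamma> t R N (br \<gamma> t R N)"
    if "\<gamma> < \<kappa>" "t \<in> P \<gamma>" "finite R" "R \<subseteq> good_upto X \<kappa>" for \<gamma> t R N
    unfolding br_def using nice_ex[OF that] by (rule someI_ex)
  have br_L: "br \<gamma> t R N \<in> L"
    if "\<gamma> < \<kappa>" "t \<in> P \<gamma>" "finite R" "R \<subseteq> good_upto X \<kappa>" for \<gamma> t R N
    unfolding L_def I_def using that by (intro image_eqI[of _ _ "(\<gamma>, t, R, N)"]) simp_all
  have LE: "\<exists>\<gamma> t R N. nice \<gamma> t R N b" if "b \<in> L" for b
  proof -
    from that obtain i where i: "i \<in> I" "b = (\<lambda>(\<gamma>, t, R, N). br \<gamma> t R N) i"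
      unfolding L_def by (rule imageE)
    obtain \<gamma> t R N where eq: "i = (\<gamma>, t, R, N)" by (cases i)
    have "nice \<gamma> t R N (br \<gamma> t R N)" by (rule nice_br) (use i(1) eq in \<open>simp_all add: I_def\<close>)
    then show ?thesis using i(2) eq by (intro exI) simp
  qed
  have "countable L"
    unfolding L_def I_def
    using countable_lessThan_omega1 countable_level countable_Collect_finite_subset[OF countable_good_upto]
    by (intro countable_image countable_SIGMA) auto
  moreover have "L \<noteq> {}"
  proof -
    obtain \<gamma> where "\<gamma> < \<kappa>" using lim by (auto simp: limit_ord_def)
    then obtain t where "t \<in> P \<gamma>" using level_nonempty by blast
    then show ?thesis using br_L[OF \<open>\<gamma> < \<kappa>\<close>, of t "{}" 0] by auto
  qed
  moreover have "\<forall>b\<in>L. dom b = {..<\<kappa>} \<and> (\<forall>\<beta><\<kappa>. b |` {..<\<beta>} \<in> P \<beta>)"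
  proof
    fix b assume "b \<in> L"
    from LE[OF this] show "dom b = {..<\<kappa>} \<and> (\<forall>\<beta><\<kappa>. b |` {..<\<beta>} \<in> P \<beta>)"
      unfolding nice_def by (elim exE conjE) (intro conjI)
  qed
  moreover have "\<forall>\<beta><\<kappa>. (\<forall>\<gamma>>\<beta>. \<not> \<gamma> < \<kappa>) \<longrightarrow> (\<forall>t\<in>P \<beta>. \<forall>b. t(\<beta> \<mapsto> b) \<in> L)"
    using lim unfolding limit_ord_def by blast
  moreover have "\<forall>\<gamma><\<kappa>. \<forall>t\<in>P \<gamma>. \<forall>R N. finite R \<longrightarrow> R \<subseteq> good_upto X \<kappa> \<longrightarrow>
      (\<exists>t'\<in>L. t \<subseteq>\<^sub>m t' \<and>
        (\<forall>d\<in>R. \<forall>\<delta>\<in>d. \<gamma> < \<delta> \<longrightarrow> \<delta> < \<kappa> \<longrightarrow> N \<le> to_nat_on (P \<delta>) (t' |` {..<\<delta>})))"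
  proof (intro allI ballI impI)
    fix \<gamma> t R and N :: nat
    assume "\<gamma> < \<kappa>" "t \<in> P \<gamma>" "finite R" "R \<subseteq> good_upto X \<kappa>"
    note * = this
    show "\<exists>t'\<in>L. t \<subseteq>\<^sub>m t' \<and>
        (\<forall>d\<in>R. \<forall>\<delta>\<in>d. \<gamma> < \<delta> \<longrightarrow> \<delta> < \<kappa> \<longrightarrow> N \<le> to_nat_on (P \<delta>) (t' |` {..<\<delta>}))"
      using br_L[OF *] nice_br[OF *, unfolded nice_def] by (intro bexI[of _ "br \<gamma> t R N"]) simp_all
  qed
  moreover have "\<forall>b\<in>L. \<forall>d\<in>good_upto X \<kappa>. \<forall>N. finite {\<delta>\<in>d. \<delta> < \<kappa> \<and> to_nat_on (P \<delta>) (b |` {..<\<delta>}) < N}"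
  proof
    fix b assume "b \<in> L"
    from LE[OF this] show "\<forall>d\<in>good_upto X \<kappa>. \<forall>N. finite {\<delta>\<in>d. \<delta> < \<kappa> \<and> to_nat_on (P \<delta>) (b |` {..<\<delta>}) < N}"
      unfolding nice_def by (elim exE conjE)
  qed
  moreover have "\<kappa> \<in> X \<longrightarrow> limit_ord \<kappa> \<longrightarrow> (\<forall>b\<in>L. \<forall>Z\<in>\<S> \<kappa>. \<exists>\<beta><\<kappa>.
      (\<exists>s\<in>decode P \<kappa> Z. s \<subseteq>\<^sub>m b |` {..<\<beta>}) \<or> (\<forall>s\<in>decode P \<kappa> Z. \<not> b |` {..<\<beta>} \<subseteq>\<^sub>m s))"
  proof (intro impI ballI)
    fix b Z assume "\<kappa> \<in> X" "b \<in> L" "Z \<in> \<S> \<kappa>"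
    then show "\<exists>\<beta><\<kappa>. (\<exists>s\<in>decode P \<kappa> Z. s \<subseteq>\<^sub>m b |` {..<\<beta>}) \<or> (\<forall>s\<in>decode P \<kappa> Z. \<not> b |` {..<\<beta>} \<subseteq>\<^sub>m s)"
      using LE[OF \<open>b \<in> L\<close>] unfolding nice_def by (elim exE conjE) simp
  qed
  ultimately have "level_ok X \<kappa> P L" unfolding level_ok_def by (intro conjI)
  then show ?thesis by blast
qed

text \<open>The remaining levels are the root and the successor levels with all one-bit extensions.
  No good set has its maximum there, so plain extension of nodes suffices.\<close>

lemma level_exists: "\<exists>L. level_ok X \<kappa> P L"
proof (cases "limit_ord \<kappa>")
  case True
  then show ?thesis by (rule limit_level_exists)
next
  case nlim: False
  then have good: "good_upto X \<kappa> = {}" by (simp add: good_upto_empty)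
  show ?thesis
  proof (cases "{..<\<kappa>} = {}")
    case True
    then have no: "\<not> \<beta> < \<kappa>" for \<beta> by auto
    have "level_ok X \<kappa> P {Map.empty}" unfolding level_ok_def by (simp add: no good nlim True)
    then show ?thesis by blast
  next
    case False
    then obtain \<beta> where \<beta>: "\<beta> < \<kappa>" "\<And>\<gamma>. \<beta> < \<gamma> \<Longrightarrow> \<not> \<gamma> < \<kappa>"
      using nlim unfolding limit_ord_def by blast
    have le: "\<gamma> \<le> \<beta>" if "\<gamma> < \<kappa>" for \<gamma> using \<beta>(2)[of \<gamma>] that by (metis leI)
    have below: "{..<\<kappa>} = insert \<beta> {..<\<beta>}" using le \<beta>(1) by (auto simp: le_less intro: less_trans)
    define L where "L = (\<lambda>(t, b). t(\<beta> \<mapsto> b)) ` (P \<beta> \<times> (UNIV :: bool set))"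
    have t_le: "t \<subseteq>\<^sub>m t(\<beta> \<mapsto> b)" if "t \<in> P \<beta>" for t b
      using dom_node[OF \<beta>(1) that] by (auto simp: map_le_def)
    have LE: "\<exists>t\<in>P \<beta>. \<exists>c. b = t(\<beta> \<mapsto> c)" if "b \<in> L" for b
      using that unfolding L_def by auto
    have LI: "t(\<beta> \<mapsto> c) \<in> L" if "t \<in> P \<beta>" for t c
      using that unfolding L_def by auto
    have "countable L" unfolding L_def using countable_level[OF \<beta>(1)] by simp
    moreover have "L \<noteq> {}" using level_nonempty[OF \<beta>(1)] LI by blast
    moreover have "\<forall>b\<in>L. dom b = {..<\<kappa>} \<and> (\<forall>\<gamma><\<kappa>. b |` {..<\<gamma>} \<in> P \<gamma>)"
    proof
      fix b assume "b \<in> L"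
      then obtain t c where t: "t \<in> P \<beta>" "b = t(\<beta> \<mapsto> c)" using LE by blast
      have "b |` {..<\<gamma>} \<in> P \<gamma>" if "\<gamma> < \<kappa>" for \<gamma>
        using restrict_agree[OF t_le[OF t(1)] dom_node[OF \<beta>(1) t(1)] le[OF that]]
          restrict_node[OF \<beta>(1) t(1) le[OF that]] t(2) by simp
      then show "dom b = {..<\<kappa>} \<and> (\<forall>\<gamma><\<kappa>. b |` {..<\<gamma>} \<in> P \<gamma>)"
        using t(2) dom_node[OF \<beta>(1) t(1)] below by simp
    qed
    moreover have "\<forall>\<gamma><\<kappa>. (\<forall>\<eta>>\<gamma>. \<not> \<eta> < \<kappa>) \<longrightarrow> (\<forall>t\<in>P \<gamma>. \<forall>b. t(\<gamma> \<mapsto> b) \<in> L)"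
    proof (intro allI impI)
      fix \<gamma> assume "\<gamma> < \<kappa>" "\<forall>\<eta>>\<gamma>. \<not> \<eta> < \<kappa>"
      then have "\<gamma> = \<beta>" using le[of \<gamma>] \<beta>(1) by (auto simp: le_less)
      then show "\<forall>t\<in>P \<gamma>. \<forall>b. t(\<gamma> \<mapsto> b) \<in> L" using LI by simp
    qed
    moreover have "\<exists>t'\<in>L. t \<subseteq>\<^sub>m t'" if \<gamma>: "\<gamma> < \<kappa>" "t \<in> P \<gamma>" for \<gamma> t
    proof -
      obtain u where u: "u \<in> P \<beta>" "t \<subseteq>\<^sub>m u" using extend_node[OF \<beta>(1) le[OF \<gamma>(1)] \<gamma>(2)] .
      then show ?thesis using LI[OF u(1), of True] map_le_trans[OF u(2) t_le[OF u(1)]] by blast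
    qed
    ultimately have "level_ok X \<kappa> P L" unfolding level_ok_def by (simp add: good nlim)
    then show ?thesis by blast
  qed
qed

end

section \<open>The trees\<close>

definition ht :: "binseq \<Rightarrow> omega1"
  where "ht t = (THE \<alpha>. dom t = {..<\<alpha>})"

lemma ht_eq: "dom t = {..<\<alpha>} \<Longrightarrow> ht t = \<alpha>"
  unfolding ht_def by (simp add: lessThan_eq_iff)

lemma branchD:
  assumes "branch T B"
  shows "B \<subseteq> T" and "s \<in> B \<Longrightarrow> t \<in> B \<Longrightarrow> s \<subseteq>\<^sub>m t \<or> t \<subseteq>\<^sub>m s"
proof -
  have chain: "pred_on.chain T (\<subseteq>\<^sub>m) B"
    using assms unfolding pred_on.maxchain_def by (rule conjunct1)
  then show "B \<subseteq> T" unfolding pred_on.chain_def by (rule conjunct1)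
  show "s \<subseteq>\<^sub>m t \<or> t \<subseteq>\<^sub>m s" if st: "s \<in> B" "t \<in> B"
    using bspec[OF bspec[OF conjunct2[OF chain[unfolded pred_on.chain_def]] st(1)] st(2)] by auto
qed

text \<open>The fibres of \<open>l\<close> are countably many antichains, and \<open>l\<close> maps
  each branch injectively into a countable type.\<close>

lemma special_aronszajn_tree_if_labelled:
  fixes l :: "binseq \<Rightarrow> 'c :: countable"
  assumes T: "aleph1_subtree T"
    and l: "\<And>s t. s \<in> T \<Longrightarrow> t \<in> T \<Longrightarrow> s \<subseteq>\<^sub>m t \<Longrightarrow> s \<noteq> t \<Longrightarrow> l s \<noteq> l t"
  shows "special_aronszajn_tree T"
proof -
  have "countable B" if B: "branch T B" for B
  proof -
    have "inj_on l B"
    proof (rule inj_onI, rule ccontr)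
      fix s t assume st: "s \<in> B" "t \<in> B" "l s = l t" "s \<noteq> t"
      then have "s \<in> T" "t \<in> T" using branchD(1)[OF B] by blast+
      then show False using branchD(2)[OF B st(1,2)] l[of s t] l[of t s] st(3,4) by auto
    qed
    then show ?thesis by (rule countable_image_inj_on[rotated]) simp
  qed
  then have 1: "aronszajn_tree T" unfolding aronszajn_tree_def using T by blast
  let ?F = "range (\<lambda>c. {t\<in>T. l t = c})"
  have "\<not> s \<subseteq>\<^sub>m t" if "s \<in> T" "t \<in> T" "l s = l t" "s \<noteq> t" for s t
    using l[OF that(1,2) _ that(4)] that(3) by blast
  then have "antichain T {t\<in>T. l t = c}" for c
    unfolding antichain_def by auto
  then have "\<forall>A\<in>?F. antichain T A" by blast
  moreover have "T = \<Union>?F" by blast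
  moreover have "countable ?F" by simp
  ultimately show ?thesis
    unfolding special_aronszajn_tree_def using 1 by blast
qed

section \<open>Recursive choice of the levels and coherence of the trees\<close>

context guessing
begin

text \<open>\<open>SOME\<close> depends only on the predicate, so sets \<open>X\<close> that impose
  the same requirements receive literally the same level.\<close>

definition Lv :: "omega1 set \<Rightarrow> omega1 \<Rightarrow> binseq set"
  where "Lv X = wfrec {(\<beta>, \<alpha>). \<beta> < \<alpha>} (\<lambda>P \<alpha>. SOME L. level_ok X \<alpha> P L)"

text \<open>\<open>level_ok\<close> ignores \<open>P\<close> at and above \<open>\<alpha>\<close>,
  so the cut-off made by \<open>wfrec\<close> has no effect.\<close>

lemma Lv_unfold: "Lv X \<alpha> = (SOME L. level_ok X \<alpha> (Lv X) L)"
proof -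
  let ?R = "{(\<beta>, \<alpha>). \<beta> < (\<alpha> :: omega1)}"
  have "Lv X \<alpha> = (SOME L. level_ok X \<alpha> (cut (Lv X) ?R \<alpha>) L)"
    using wfrec[OF wf, of "\<lambda>P \<alpha>. SOME L. level_ok X \<alpha> P L" \<alpha>] unfolding Lv_def .
  moreover have "level_ok X \<alpha> (cut (Lv X) ?R \<alpha>) L = level_ok X \<alpha> (Lv X) L" for L
    by (rule level_ok_cong) (simp_all add: cut_apply)
  ultimately show ?thesis by simp
qed

lemma Lv_ok: "level_ok X \<alpha> (Lv X) (Lv X \<alpha>)"
proof (induction \<alpha> rule: less_induct)
  case (less \<alpha>)
  interpret partial_tree \<A> \<S> X "Lv X" \<alpha>
    by unfold_locales (rule less)
  show ?case using someI_ex[OF level_exists] by (simp only: Lv_unfold[of X \<alpha>, symmetric])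
qed

lemma partial_tree_Lv: "partial_tree \<A> \<S> X (Lv X) \<kappa>"
  by unfold_locales (rule Lv_ok)

text \<open>By induction the two predicates passed to \<open>SOME\<close> coincide. Membership of
  \<open>\<alpha>\<close> itself matters, as it decides whether a limit level is sealed.\<close>

lemma Lv_cong:
  assumes "X \<inter> {..\<alpha>} = Y \<inter> {..\<alpha>}"
  shows "Lv X \<alpha> = Lv Y \<alpha>"
  using assms
proof (induction \<alpha> rule: less_induct)
  case (less \<alpha>)
  have "Lv X \<beta> = Lv Y \<beta>" if "\<beta> < \<alpha>" for \<beta>
  proof (rule less.IH[OF that])
    have "{..\<beta>} \<subseteq> {..\<alpha>}" using that by auto
    with less.prems show "X \<inter> {..\<beta>} = Y \<inter> {..\<beta>}" by (rule Int_eq_Int_subset)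
  qed
  then have "level_ok X \<alpha> (Lv X) L = level_ok Y \<alpha> (Lv Y) L" for L
    by (rule level_ok_cong[OF _ less.prems])
  then have "level_ok X \<alpha> (Lv X) = level_ok Y \<alpha> (Lv Y)" by (rule ext)
  then show ?case unfolding Lv_unfold[of X \<alpha>] Lv_unfold[of Y \<alpha>] by (simp only:)
qed

lemma dom_Lv: "t \<in> Lv X \<alpha> \<Longrightarrow> dom t = {..<\<alpha>}"
  using level_ok_node[OF Lv_ok[of X \<alpha>]] by simp

lemma ht_Lv: "t \<in> Lv X \<alpha> \<Longrightarrow> ht t = \<alpha>"
  using ht_eq[OF dom_Lv] .

lemma restrict_Lv:
  assumes "t \<in> Lv X \<beta>" "\<gamma> \<le> \<beta>"
  shows "t |` {..<\<gamma>} \<in> Lv X \<gamma>"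
proof -
  obtain \<kappa> where "\<beta> < \<kappa>" using omega1_gt_ex by blast
  then show ?thesis using partial_tree.restrict_node[OF partial_tree_Lv _ assms] by blast
qed

lemma countable_Lv: "countable (Lv X \<alpha>)" and Lv_nonempty: "Lv X \<alpha> \<noteq> {}"
  using level_ok_countable[OF Lv_ok] level_ok_nonempty[OF Lv_ok] by auto

definition Tree :: "omega1 set \<Rightarrow> binseq set"
  where "Tree X = (\<Union>\<alpha>. Lv X \<alpha>)"

lemma Tree_ht: "t \<in> Tree X \<Longrightarrow> t \<in> Lv X (ht t)"
  unfolding Tree_def using ht_Lv by auto

lemma subtree_Tree: "subtree (Tree X)"
  unfolding subtree_def Tree_def binseqs_def using dom_Lv by blast

lemma downward_closed_Tree: "downward_closed (Tree X)"
  unfolding downward_closed_def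
proof (intro ballI impI)
  fix t s assume t: "t \<in> Tree X" and s: "s \<in> binseqs" "s \<subseteq>\<^sub>m t"
  obtain \<beta> where \<beta>: "dom s = {..<\<beta>}" using s(1) by (auto simp: binseqs_def)
  have "dom s \<subseteq> dom t" using s(2) by (rule map_le_implies_dom_le)
  then have "\<beta> \<le> ht t" using \<beta> dom_Lv[OF Tree_ht[OF t]] by simp
  then have "t |` {..<\<beta>} \<in> Lv X \<beta>" using restrict_Lv[OF Tree_ht[OF t]] by simp
  then show "s \<in> Tree X" using binseq_restrict_eq[OF s(2) \<beta>] unfolding Tree_def by auto
qed

lemma has_height_Tree: "t \<in> Tree X \<Longrightarrow> has_height (Tree X) t \<xi> \<longleftrightarrow> t \<in> Lv X \<xi>"
  using has_height_iff_dom[OF subtree_Tree downward_closed_Tree] ht_eq Tree_ht dom_Lv by metis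

lemma level_Tree: "level (Tree X) \<xi> = Lv X \<xi>"
  using has_height_Tree unfolding level_def by (auto simp: Tree_def)

lemma tree_restrict_Tree: "tree_restrict (Tree X) \<alpha> = (\<Union>\<xi>\<in>{..<\<alpha>}. Lv X \<xi>)"
proof -
  have "t \<in> Tree X \<and> (\<exists>\<xi><\<alpha>. has_height (Tree X) t \<xi>) \<longleftrightarrow> t \<in> Tree X \<and> (\<exists>\<xi><\<alpha>. t \<in> Lv X \<xi>)" for t
    by (cases "t \<in> Tree X") (simp_all add: has_height_Tree)
  then show ?thesis unfolding tree_restrict_def by (auto simp: Tree_def)
qed

lemma aleph1_subtree_Tree: "aleph1_subtree (Tree X)"
  unfolding aleph1_subtree_def using subtree_Tree countable_Lv Lv_nonempty by (simp add: level_Tree)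

lemma tree_restrict_Tree_cong:
  assumes "X \<inter> {..<\<alpha>} = Y \<inter> {..<\<alpha>}"
  shows "tree_restrict (Tree X) \<alpha> = tree_restrict (Tree Y) \<alpha>"
proof -
  have "Lv X \<xi> = Lv Y \<xi>" if "\<xi> < \<alpha>" for \<xi>
  proof (rule Lv_cong)
    have "{..\<xi>} \<subseteq> {..<\<alpha>}" using that by auto
    with assms show "X \<inter> {..\<xi>} = Y \<inter> {..\<xi>}" by (rule Int_eq_Int_subset)
  qed
  then show ?thesis unfolding tree_restrict_Tree by simp
qed

lemma Tree_less:
  assumes "s \<in> Tree X" "t \<in> Tree X" "s \<subseteq>\<^sub>m t" "s \<noteq> t"
  shows "ht s < ht t"
proof -
  have ds: "dom s = {..<ht s}" and dt: "dom t = {..<ht t}" using assms Tree_ht dom_Lv by blast+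
  have "ht s \<le> ht t" using map_le_implies_dom_le[OF assms(3)] ds dt by simp
  moreover have "ht s \<noteq> ht t"
  proof
    assume "ht s = ht t"
    then have "t |` {..<ht t} = s" using binseq_restrict_eq[OF assms(3)] ds by simp
    moreover have "t |` {..<ht t} = t" using binseq_restrict_eq[OF map_le_refl dt] .
    ultimately show False using assms(4) by simp
  qed
  ultimately show ?thesis by simp
qed

lemma countable_below: "countable (\<Union>\<xi>\<in>{..<\<alpha>}. Lv X \<xi>)"
  using countable_lessThan_omega1 countable_Lv by blast

section \<open>Non-stationary sets: special trees\<close>

text \<open>\<open>C\<close> cuts the heights into blocks. The second component of the label
  \<open>l\<close> separates nodes of one block by enumerating the countable part of the tree below
  the next point of \<open>C\<close>. The first separates comparable nodes of different blocks: it
  records the index at the last point of \<open>C\<close> and how often that index occurred before,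
  with \<open>None\<close> below the first point.\<close>

lemma special_Tree:
  assumes C: "club C" "good X C"
  shows "special_aronszajn_tree (Tree X)"
proof -
  have oc: "order_closed C" using C by (simp add: club_def)
  define mx where "mx \<gamma> = (SOME \<delta>. \<delta> \<in> C \<and> \<delta> \<le> \<gamma> \<and> (\<forall>\<eta>\<in>C. \<eta> \<le> \<gamma> \<longrightarrow> \<eta> \<le> \<delta>))" for \<gamma>
  define nx where "nx \<gamma> = (LEAST \<eta>. \<eta> \<in> C \<and> \<gamma> < \<eta>)" for \<gamma>
  have mx: "mx \<gamma> \<in> C \<and> mx \<gamma> \<le> \<gamma> \<and> (\<forall>\<eta>\<in>C. \<eta> \<le> \<gamma> \<longrightarrow> \<eta> \<le> mx \<gamma>)" if \<delta>: "\<delta> \<in> C" "\<delta> \<le> \<gamma>" for \<gamma> \<delta>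
  proof -
    obtain \<delta>' where "\<delta>' \<in> C \<and> \<delta>' \<le> \<gamma> \<and> (\<forall>\<eta>\<in>C. \<eta> \<le> \<gamma> \<longrightarrow> \<eta> \<le> \<delta>')"
      by (rule order_closed_has_max[OF oc \<delta>]) blast
    then show ?thesis unfolding mx_def by (rule someI)
  qed
  have nx: "nx \<gamma> \<in> C \<and> \<gamma> < nx \<gamma>" for \<gamma>
  proof -
    obtain \<eta> where "\<eta> \<in> C \<and> \<gamma> < \<eta>" using C(1) unfolding club_def unbounded_def by blast
    then show ?thesis unfolding nx_def by (rule LeastI)
  qed
  have nx_le: "nx \<gamma> \<le> \<eta>" if "\<eta> \<in> C" "\<gamma> < \<eta>" for \<gamma> \<eta>
    unfolding nx_def using that by (intro Least_le) simp
  define ix where "ix t \<delta> = to_nat_on (Lv X \<delta>) (t |` {..<\<delta>})" for t \<delta>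
  \<comment> \<open>Index equal to \<open>k\<close> is a case of index less than
    \<open>Suc k\<close>.\<close>
  have fin: "finite {\<delta>\<in>C. \<delta> < \<gamma> \<and> ix t \<delta> = k}" if "t \<in> Lv X \<beta>" "\<gamma> \<le> \<beta>" for t \<beta> \<gamma> k
  proof -
    obtain \<kappa> where "\<beta> < \<kappa>" using omega1_gt_ex by blast
    from partial_tree.finite_small_index[OF partial_tree_Lv C(2) this that(1), of "Suc k"]
    show ?thesis unfolding ix_def by (rule rev_finite_subset) (use that(2) in auto)
  qed
  define l where "l t = (if \<exists>\<delta>\<in>C. \<delta> \<le> ht t
      then Some (ix t (mx (ht t)), card {\<delta>\<in>C. \<delta> < mx (ht t) \<and> ix t \<delta> = ix t (mx (ht t))})
      else None, to_nat_on (\<Union>\<xi>\<in>{..<nx (ht t)}. Lv X \<xi>) t)" for t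
  show ?thesis
  proof (rule special_aronszajn_tree_if_labelled[of _ l, OF aleph1_subtree_Tree])
    fix s t assume st: "s \<in> Tree X" "t \<in> Tree X" "s \<subseteq>\<^sub>m t" "s \<noteq> t"
    have less: "ht s < ht t" using Tree_less[OF st] .
    have s: "s \<in> Lv X (ht s)" and t: "t \<in> Lv X (ht t)" using st Tree_ht by blast+
    show "l s \<noteq> l t"
    proof (cases "nx (ht s) \<le> ht t")
      case False
      then have "nx (ht t) \<le> nx (ht s)" using nx[of "ht s"] by (intro nx_le) simp_all
      moreover have "nx (ht s) \<le> nx (ht t)" using nx[of "ht t"] less by (intro nx_le) auto
      ultimately have eq: "nx (ht s) = nx (ht t)" by simp
      let ?U = "\<Union>\<xi>\<in>{..<nx (ht t)}. Lv X \<xi>"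
      have "s \<in> ?U" using s nx[of "ht s"] unfolding eq by blast
      moreover have "t \<in> ?U" using t nx[of "ht t"] by blast
      ultimately have "to_nat_on ?U s \<noteq> to_nat_on ?U t"
        using st(4) to_nat_on_inj[OF countable_below] by simp
      then show ?thesis unfolding l_def eq by simp
    next
      case True
      let ?\<delta>' = "mx (ht t)"
      have ct: "\<exists>\<delta>\<in>C. \<delta> \<le> ht t" using True nx by blast
      \<comment> \<open>As \<open>t\<close> lies beyond the block of \<open>s\<close>, the last
        point of \<open>C\<close> for \<open>t\<close> is above \<open>ht s\<close>.\<close>
      have \<delta>': "?\<delta>' \<in> C" "?\<delta>' \<le> ht t" "nx (ht s) \<le> ?\<delta>'" using mx[OF _ True] nx[of "ht s"] True by auto
      show ?thesis
      proof (cases "\<exists>\<delta>\<in>C. \<delta> \<le> ht s")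
        case False
        then have "fst (l s) = None" "fst (l t) \<noteq> None" using ct unfolding l_def by simp_all
        then show ?thesis by auto
      next
        case cs: True
        let ?\<delta> = "mx (ht s)"
        obtain \<delta>0 where "\<delta>0 \<in> C" "\<delta>0 \<le> ht s" using cs by blast
        then have \<delta>: "?\<delta> \<in> C" "?\<delta> \<le> ht s" using mx[of \<delta>0 "ht s"] by simp_all
        have "?\<delta> < ?\<delta>'" using \<delta>(2) nx[of "ht s"] \<delta>'(3) by auto
        have ix_st: "ix s \<eta> = ix t \<eta>" if "\<eta> \<le> ht s" for \<eta>
          unfolding ix_def using restrict_agree[OF st(3) dom_Lv[OF s] that] by simp
        show ?thesis
        proof
          assume "l s = l t"
          then have k: "ix s ?\<delta> = ix t ?\<delta>'"
            and c: "card {\<delta>\<in>C. \<delta> < ?\<delta> \<and> ix s \<delta> = ix s ?\<delta>} = card {\<delta>\<in>C. \<delta> < ?\<delta>' \<and> ix t \<delta> = ix t ?\<delta>'}"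
            unfolding l_def if_P[OF cs] if_P[OF ct] prod.inject option.inject by - (elim conjE, assumption)+
          let ?A = "{\<delta>\<in>C. \<delta> < ?\<delta> \<and> ix s \<delta> = ix s ?\<delta>}" and ?B = "{\<delta>\<in>C. \<delta> < ?\<delta>' \<and> ix t \<delta> = ix t ?\<delta>'}"
          have fin_B: "finite ?B" using fin[OF t \<delta>'(2)] .
          have sub: "?A \<subseteq> ?B"
          proof
            fix \<eta> assume \<eta>: "\<eta> \<in> ?A"
            then have "\<eta> \<le> ht s" using \<delta>(2) by auto
            then have "ix t \<eta> = ix t ?\<delta>'" using ix_st \<eta> k by simp
            then show "\<eta> \<in> ?B" using \<eta> \<open>?\<delta> < ?\<delta>'\<close> by auto
          qed
          \<comment> \<open>With equal indices, every occurrence counted for \<open>s\<close> is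
            counted for \<open>t\<close>, and \<open>?\<delta>\<close> is a new one, so the counts
            differ.\<close>
          have in_B: "?\<delta> \<in> ?B" using \<delta> \<open>?\<delta> < ?\<delta>'\<close> ix_st k by simp
          have "?A \<noteq> ?B"
          proof
            assume "?A = ?B"
            from in_B[folded this] show False by simp
          qed
          from psubset_card_mono[OF fin_B psubsetI[OF sub this]] have "card ?A < card ?B" .
          then show False unfolding c by (rule notE[OF less_irrefl])
        qed
      qed
    qed
  qed
qed

section \<open>Stationary sets: Suslin trees\<close>

text \<open>The nodes branching off an uncountable chain form an uncountable antichain.\<close>

lemma countable_chain_Tree:
  assumes B: "B \<subseteq> Tree X" "\<And>s t. s \<in> B \<Longrightarrow> t \<in> B \<Longrightarrow> s \<subseteq>\<^sub>m t \<or> t \<subseteq>\<^sub>m s"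
    and anti: "\<And>A. antichain (Tree X) A \<Longrightarrow> countable A"
  shows "countable B"
proof (rule ccontr)
  assume unc: "uncountable B"
  have dom_B: "dom t = {..<ht t}" if "t \<in> B" for t
    using dom_Lv[OF Tree_ht[OF subsetD[OF B(1) that]]] .
  have inj_ht: "inj_on ht B"
  proof (rule inj_onI, rule ccontr)
    fix s t assume st: "s \<in> B" "t \<in> B" "ht s = ht t" "s \<noteq> t"
    have T: "s \<in> Tree X" "t \<in> Tree X" using st(1,2) B(1) by blast+
    from B(2)[OF st(1,2)] show False
    proof
      assume "s \<subseteq>\<^sub>m t"
      from Tree_less[OF T this st(4)] show False using st(3) by simp
    next
      assume "t \<subseteq>\<^sub>m s"
      from Tree_less[OF T(2,1) this st(4)[symmetric]] show False using st(3) by simp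
    qed
  qed
  have unb: "\<exists>u\<in>B. \<xi> < ht u" for \<xi>
  proof (rule ccontr)
    assume "\<not> (\<exists>u\<in>B. \<xi> < ht u)"
    then have "ht ` B \<subseteq> insert \<xi> {..<\<xi>}" by (auto simp: not_less le_less)
    moreover have "countable (insert \<xi> {..<\<xi>})" using countable_lessThan_omega1 by simp
    ultimately have "countable (ht ` B)" by (rule countable_subset)
    from countable_image_inj_on[OF this inj_ht] show False using unc by simp
  qed
  define u where "u t = (SOME u. u \<in> B \<and> ht t < ht u)" for t
  have u: "u t \<in> B" "ht t < ht (u t)" for t
    using someI_ex[OF unb[of "ht t", unfolded Bex_def]] unfolding u_def by simp_all
  \<comment> \<open>\<open>a t\<close> leaves the chain just above \<open>t\<close>: its last bit is
    opposite to that of every longer member of \<open>B\<close>.\<close>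
  define a where "a t = t(ht t \<mapsto> \<not> the (u t (ht t)))" for t
  have agree: "s x = t x" if "s \<in> B" "t \<in> B" "x < ht s" "x < ht t" for s t x
    using B(2)[OF that(1,2)]
  proof
    assume "s \<subseteq>\<^sub>m t"
    moreover have "x \<in> dom s" using dom_B[OF that(1)] that(3) by simp
    ultimately show ?thesis unfolding map_le_def by simp
  next
    assume "t \<subseteq>\<^sub>m s"
    moreover have "x \<in> dom t" using dom_B[OF that(2)] that(4) by simp
    ultimately show ?thesis unfolding map_le_def by simp
  qed
  \<comment> \<open>The disagreement is at \<open>ht s\<close>, where \<open>a t\<close> keeps the
    bit of the chain and \<open>a s\<close> flips it.\<close>
  have differ: "\<exists>x y z. a s x = Some y \<and> a t x = Some z \<and> y \<noteq> z" if st: "s \<in> B" "t \<in> B" "ht s < ht t" for s t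
  proof -
    have "ht s \<in> dom t" using dom_B[OF st(2)] st(3) by simp
    then obtain z where z: "t (ht s) = Some z" by blast
    have "u s (ht s) = t (ht s)" using agree[OF u(1) st(2) u(2) st(3)] .
    then have "a s (ht s) = Some (\<not> z)" using z unfolding a_def by simp
    moreover have "a t (ht s) = Some z" using z less_imp_neq[OF st(3)] unfolding a_def by simp
    ultimately show ?thesis by (intro exI[of _ "ht s"] exI) simp
  qed
  have incomp: "\<not> a s \<subseteq>\<^sub>m a t" if st: "s \<in> B" "t \<in> B" "s \<noteq> t" for s t
  proof
    assume le: "a s \<subseteq>\<^sub>m a t"
    have "ht s \<noteq> ht t" using inj_ht st by (meson inj_onD)
    then have "ht s < ht t \<or> ht t < ht s" by (rule neq_iff[THEN iffD1])
    then obtain x y z where "a s x = Some y" "a t x = Some z" "y \<noteq> z"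
      using differ[OF st(1,2)] differ[OF st(2,1)] by blast
    then show False using map_le_SomeD[OF le] by simp
  qed
  have a_Tree: "a t \<in> Tree X" if t: "t \<in> B" for t
  proof -
    define \<gamma> where "\<gamma> = (LEAST \<gamma>. ht t < \<gamma>)"
    obtain \<gamma>0 where "ht t < \<gamma>0" using omega1_gt_ex by blast
    then have "ht t < \<gamma>" unfolding \<gamma>_def by (rule LeastI)
    moreover have "\<forall>x>ht t. \<not> x < \<gamma>" unfolding \<gamma>_def using not_less_Least by blast
    moreover have "t \<in> Lv X (ht t)" using Tree_ht[OF subsetD[OF B(1) t]] .
    ultimately have "a t \<in> Lv X \<gamma>" using level_ok_split[OF Lv_ok[of X \<gamma>]] unfolding a_def by blast
    then show ?thesis unfolding Tree_def by blast
  qed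
  have inj_a: "inj_on a B"
  proof (rule inj_onI, rule ccontr)
    fix s t assume "s \<in> B" "t \<in> B" "a s = a t" "s \<noteq> t"
    then show False using incomp[of s t] by simp
  qed
  have "antichain (Tree X) (a ` B)"
    unfolding antichain_def
  proof (intro conjI ballI impI)
    show "a ` B \<subseteq> Tree X" using a_Tree by (rule image_subsetI)
    fix x y assume "x \<in> a ` B" "y \<in> a ` B" "x \<noteq> y"
    then obtain s t where st: "s \<in> B" "t \<in> B" "x = a s" "y = a t" by (elim imageE)
    with \<open>x \<noteq> y\<close> have "s \<noteq> t" by auto
    then show "\<not> x \<subseteq>\<^sub>m y" "\<not> y \<subseteq>\<^sub>m x" using incomp[of s t] incomp[of t s] st by simp_all
  qed
  from countable_image_inj_on[OF anti[OF this] inj_a] show False using unc by simp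
qed

text \<open>Some \<open>\<alpha> \<in> X\<close> both guesses the antichain and reflects it: a node
  below \<open>\<alpha>\<close> that extends into \<open>A\<close> does so below
  \<open>\<alpha>\<close>. Sealing at \<open>\<alpha>\<close> then keeps \<open>A\<close> below
  level \<open>\<alpha>\<close>. Branches are countable because antichains are.\<close>

lemma suslin_Tree:
  assumes X: "stationary X"
    and guess: "\<And>Z. \<exists>C. club C \<and> (\<forall>\<alpha>\<in>C. Z \<inter> ({..<\<alpha>} \<times> UNIV) \<in> \<S> \<alpha>)"
  shows "suslin_tree (Tree X)"
proof -
  have anti: "countable A" if A: "antichain (Tree X) A" for A
  proof -
    define Z where "Z = {(\<xi>, n). from_nat_into (Lv X \<xi>) n \<in> A}"
    obtain C where C: "club C" "\<And>\<alpha>. \<alpha> \<in> C \<Longrightarrow> Z \<inter> ({..<\<alpha>} \<times> UNIV) \<in> \<S> \<alpha>"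
      using guess[of Z] by (elim exE conjE) simp
    define e where "e t = (SOME s. s \<in> A \<and> t \<subseteq>\<^sub>m s)" for t
    have e: "e t \<in> A \<and> t \<subseteq>\<^sub>m e t" if "s \<in> A" "t \<subseteq>\<^sub>m s" for s t
      unfolding e_def using someI[of "\<lambda>s. s \<in> A \<and> t \<subseteq>\<^sub>m s"] that by blast
    have "\<exists>\<beta>. \<forall>t\<in>Lv X \<xi>. ht (e t) < \<beta>" for \<xi>
    proof -
      have "countable ((\<lambda>t. ht (e t)) ` Lv X \<xi>)" using countable_Lv by simp
      then obtain \<beta> where "\<And>a. a \<in> (\<lambda>t. ht (e t)) ` Lv X \<xi> \<Longrightarrow> a < \<beta>"
        using countable_imp_bounded_omega1 by blast
      then show ?thesis by (intro exI[of _ \<beta>]) simp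
    qed
    then have "\<exists>g. \<forall>\<xi>. \<forall>t\<in>Lv X \<xi>. ht (e t) < g \<xi>" by (rule choice[OF allI])
    then obtain g where g: "\<And>\<xi> t. t \<in> Lv X \<xi> \<Longrightarrow> ht (e t) < g \<xi>" by blast
    have "club (C \<inter> closure_points g \<inter> {\<alpha>. limit_ord \<alpha>})"
      by (intro club_Int C(1) club_closure_points club_limit_ord)
    then have "X \<inter> (C \<inter> closure_points g \<inter> {\<alpha>. limit_ord \<alpha>}) \<noteq> {}"
      using X unfolding stationary_def by blast
    then obtain \<alpha> where \<alpha>: "\<alpha> \<in> X" "\<alpha> \<in> C" "\<alpha> \<in> closure_points g" "limit_ord \<alpha>" by blast
    let ?Z = "Z \<inter> ({..<\<alpha>} \<times> UNIV)"
    \<comment> \<open>Decoding the guess recovers exactly the members of \<open>A\<close> below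
      level \<open>\<alpha>\<close>.\<close>
    have dec: "s \<in> decode (Lv X) \<alpha> ?Z \<longleftrightarrow> s \<in> A \<and> ht s < \<alpha>" for s
    proof
      assume "s \<in> decode (Lv X) \<alpha> ?Z"
      then obtain \<xi> n where "\<xi> < \<alpha>" "s = from_nat_into (Lv X \<xi>) n" "s \<in> A"
        unfolding decode_def Z_def by blast
      moreover have "ht (from_nat_into (Lv X \<xi>) n) = \<xi>" using ht_Lv[OF from_nat_into[OF Lv_nonempty]] .
      ultimately show "s \<in> A \<and> ht s < \<alpha>" by simp
    next
      assume s: "s \<in> A \<and> ht s < \<alpha>"
      then have "s \<in> Lv X (ht s)" using A Tree_ht unfolding antichain_def by blast
      then obtain n where n: "from_nat_into (Lv X (ht s)) n = s"
        using from_nat_into_surj[OF countable_Lv] by blast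
      then have "(ht s, n) \<in> ?Z" using s unfolding Z_def by simp
      then show "s \<in> decode (Lv X) \<alpha> ?Z"
        unfolding decode_def using s n by (intro CollectI exI[of _ "ht s"] exI[of _ n]) simp
    qed
    have "A \<subseteq> (\<Union>\<xi>\<in>{..<\<alpha>}. Lv X \<xi>)"
    proof
      fix s assume s: "s \<in> A"
      then have sT: "s \<in> Tree X" using A unfolding antichain_def by blast
      have "ht s < \<alpha>"
      proof (rule ccontr)
        assume "\<not> ht s < \<alpha>"
        then have le: "\<alpha> \<le> ht s" by simp
        let ?t = "s |` {..<\<alpha>}"
        have t: "?t \<in> Lv X \<alpha>" using restrict_Lv[OF Tree_ht[OF sT] le] .
        obtain \<beta> where \<beta>: "\<beta> < \<alpha>"
          and *: "(\<exists>r\<in>decode (Lv X) \<alpha> ?Z. r \<subseteq>\<^sub>m ?t |` {..<\<beta>}) \<or>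
            (\<forall>r\<in>decode (Lv X) \<alpha> ?Z. \<not> ?t |` {..<\<beta>} \<subseteq>\<^sub>m r)"
          using level_ok_seal[OF Lv_ok, rule_format, OF \<alpha>(1,4) t C(2)[OF \<alpha>(2)]] by (elim exE conjE)
        let ?u = "s |` {..<\<beta>}"
        have u_eq: "?t |` {..<\<beta>} = ?u" using \<beta> by (simp add: inf.absorb2)
        have u_le: "?u \<subseteq>\<^sub>m s" by (rule restrict_map_le)
        from * show False unfolding u_eq
        proof
          \<comment> \<open>Here \<open>s\<close> would properly extend another member of
            \<open>A\<close>.\<close>
          assume "\<exists>r\<in>decode (Lv X) \<alpha> ?Z. r \<subseteq>\<^sub>m ?u"
          then obtain r where r: "r \<in> A" "ht r < \<alpha>" "r \<subseteq>\<^sub>m ?u" using dec by blast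
          have "r \<subseteq>\<^sub>m s" using r(3) u_le by (rule map_le_trans)
          moreover have "r \<noteq> s" using r(2) le by auto
          ultimately show False using A r(1) s unfolding antichain_def by blast
        next
          \<comment> \<open>Here \<open>s\<close> shows that \<open>?u\<close> extends into
            \<open>A\<close>, so \<open>e ?u\<close> is such an extension, and closure under
            \<open>g\<close> puts it below \<open>\<alpha>\<close>.\<close>
          assume no: "\<forall>r\<in>decode (Lv X) \<alpha> ?Z. \<not> ?u \<subseteq>\<^sub>m r"
          have "?u \<in> Lv X \<beta>" using restrict_Lv[OF Tree_ht[OF sT]] \<beta> le by simp
          then have "ht (e ?u) < g \<beta>" by (rule g)
          moreover have "g \<beta> < \<alpha>" using \<alpha>(3) \<beta> unfolding closure_points_def by blast
          ultimately have "ht (e ?u) < \<alpha>" by (rule less_trans)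
          then show False using no e[OF s u_le] dec by blast
        qed
      qed
      then show "s \<in> (\<Union>\<xi>\<in>{..<\<alpha>}. Lv X \<xi>)" using Tree_ht[OF sT] by blast
    qed
    then show ?thesis using countable_below countable_subset by blast
  qed
  have "countable B" if "branch (Tree X) B" for B
  proof (rule countable_chain_Tree[OF _ _ anti])
    show "B \<subseteq> Tree X" "\<And>s t. s \<in> B \<Longrightarrow> t \<in> B \<Longrightarrow> s \<subseteq>\<^sub>m t \<or> t \<subseteq>\<^sub>m s"
      using branchD[OF that] by blast+
  qed
  then show ?thesis
    unfolding suslin_tree_def aronszajn_tree_def using aleph1_subtree_Tree anti by blast
qed

end

section \<open>Deriving both kinds of guesses from diamond plus\<close>

theorem theorem3p3:
  assumes diamond_plus
  shows "\<exists>T :: omega1 set \<Rightarrow> binseq set.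
    (\<forall>X. downward_closed (T X) \<and> aleph1_subtree (T X)) \<and>
    (\<forall>X Y \<alpha>. X \<inter> {..<\<alpha>} = Y \<inter> {..<\<alpha>} \<longrightarrow> tree_restrict (T X) \<alpha> = tree_restrict (T Y) \<alpha>) \<and>
    (\<forall>X. stationary X \<longrightarrow> suslin_tree (T X)) \<and>
    (\<forall>X. \<not> stationary X \<longrightarrow> special_aronszajn_tree (T X))"
proof -
  obtain \<D> :: "omega1 \<Rightarrow> omega1 set set" where \<D>: "\<And>\<alpha>. countable (\<D> \<alpha>)"
    and guess: "\<And>X. \<exists>C. club C \<and> (\<forall>\<alpha>\<in>C. C \<inter> {..<\<alpha>} \<in> \<D> \<alpha> \<and> X \<inter> {..<\<alpha>} \<in> \<D> \<alpha>)"
    using assms unfolding diamond_plus_def by blast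
  obtain \<pi> :: "omega1 \<times> nat \<Rightarrow> omega1" where \<pi>: "inj \<pi>" using inj_pair_omega1 by blast
  \<comment> \<open>The good club will be the set of limit ordinals in \<open>C \<inter> D\<close>,
    with \<open>C\<close> and \<open>D\<close> guessed separately; hence intersections of two
    guesses.\<close>
  define \<A> where "\<A> \<alpha> = (\<lambda>(a, b). a \<inter> b \<inter> {\<alpha>. limit_ord \<alpha>}) ` (\<D> \<alpha> \<times> \<D> \<alpha>)" for \<alpha>
  define \<S> where "\<S> \<alpha> = (\<lambda>a. {(\<xi>, n). \<xi> < \<alpha> \<and> \<pi> (\<xi>, n) \<in> a}) ` \<D> \<alpha>" for \<alpha>
  interpret guessing \<A> \<S>
    by unfold_locales (simp_all add: \<A>_def \<S>_def \<D>)
  have "\<exists>C. club C \<and> (\<forall>\<alpha>\<in>C. Z \<inter> ({..<\<alpha>} \<times> UNIV) \<in> \<S> \<alpha>)" for Z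
  proof -
    obtain C where C: "club C" "\<And>\<alpha>. \<alpha> \<in> C \<Longrightarrow> \<pi> ` Z \<inter> {..<\<alpha>} \<in> \<D> \<alpha>" using guess by blast
    have "\<exists>\<beta>. \<forall>n. \<pi> (\<xi>, n) < \<beta>" for \<xi>
      using countable_imp_bounded_omega1[of "range (\<lambda>n. \<pi> (\<xi>, n))"]
      by (metis countable_image countableI_type rangeI)
    then obtain g where g: "\<And>\<xi> n. \<pi> (\<xi>, n) < g \<xi>" by metis
    have "Z \<inter> ({..<\<alpha>} \<times> UNIV) \<in> \<S> \<alpha>" if \<alpha>: "\<alpha> \<in> C \<inter> closure_points g" for \<alpha>
    proof -
      have "\<pi> (\<xi>, n) < \<alpha>" if "\<xi> < \<alpha>" for \<xi> n
        using \<alpha> that g[of \<xi> n] unfolding closure_points_def by (auto intro: less_trans)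
      then have "Z \<inter> ({..<\<alpha>} \<times> UNIV) = {(\<xi>, n). \<xi> < \<alpha> \<and> \<pi> (\<xi>, n) \<in> \<pi> ` Z \<inter> {..<\<alpha>}}"
        using inj_image_mem_iff[OF \<pi>] by auto
      then show ?thesis unfolding \<S>_def using C(2) \<alpha> by blast
    qed
    then show ?thesis using club_Int[OF C(1) club_closure_points] by blast
  qed
  then have "suslin_tree (Tree X)" if "stationary X" for X
    using suslin_Tree[OF that] by blast
  moreover have "special_aronszajn_tree (Tree X)" if X: "\<not> stationary X" for X
  proof -
    obtain D where D: "club D" "X \<inter> D = {}" using X unfolding stationary_def by blast
    \<comment> \<open>Diamond plus is applied to the club \<open>D\<close> avoiding
      \<open>X\<close>; it returns a club \<open>C\<close> guessed together with \<open>D\<close> at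
      its own points.\<close>
    obtain C where C: "club C" "\<And>\<alpha>. \<alpha> \<in> C \<Longrightarrow> C \<inter> {..<\<alpha>} \<in> \<D> \<alpha> \<and> D \<inter> {..<\<alpha>} \<in> \<D> \<alpha>"
      using guess[of D] by blast
    let ?C = "C \<inter> D \<inter> {\<alpha>. limit_ord \<alpha>}"
    have club: "club ?C" using club_Int C(1) D(1) club_limit_ord by blast
    have "?C \<inter> {..<\<alpha>} \<in> \<A> \<alpha>" if \<alpha>: "\<alpha> \<in> ?C" for \<alpha>
    proof -
      have "?C \<inter> {..<\<alpha>} = (\<lambda>(a, b). a \<inter> b \<inter> {\<alpha>. limit_ord \<alpha>}) (C \<inter> {..<\<alpha>}, D \<inter> {..<\<alpha>})" by auto
      moreover have "(C \<inter> {..<\<alpha>}, D \<inter> {..<\<alpha>}) \<in> \<D> \<alpha> \<times> \<D> \<alpha>" using C(2)[of \<alpha>] \<alpha> by simp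
      ultimately show ?thesis unfolding \<A>_def by (rule image_eqI)
    qed
    then have "good X ?C" using club D(2) unfolding good_def club_def by blast
    then show ?thesis using special_Tree club by blast
  qed
  ultimately show ?thesis
    using downward_closed_Tree aleph1_subtree_Tree tree_restrict_Tree_cong
    by (intro exI[of _ Tree] conjI allI impI)
qed

end
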